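(* The group $B_\bullet$ is left-orderable (it admits a linear ordering compatible with multiplication on the left). The group algebra $\mathbf{C}[B_\bullet]$ has no zero divisor.
   Context: $B_\bullet$ is the group (of parenthesized braids) presented by generators $\sigma_i,a_i$ ($i\ge1$) and the relations, for all $i\ge1$ and $j\ge i+2$: $\sigma_i\sigma_j=\sigma_j\sigma_i$, $\sigma_ia_j=a_j\sigma_i$, $a_ia_{j-1}=a_ja_i$, $a_i\sigma_{j-1}=\sigma_ja_i$, $\sigma_i\sigma_{i+1}\sigma_i=\sigma_{i+1}\sigma_i\sigma_{i+1}$, $\sigma_{i+1}\sigma_ia_{i+1}=a_i\sigma_i$, $\sigma_i\sigma_{i+1}a_i=a_{i+1}\sigma_i$. *)

theory Defs
  imports Complex_Main "HOL-Algebra.Ring" "HOL-Library.Poly_Mapping"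
begin

section \<open>Groups given by generators and relations\<close>

text \<open>A word over a set \<open>X\<close> is a list of letters \<open>(x, b)\<close> with \<open>x \<in> X\<close>, where \<open>(x, True)\<close> stands for
  the generator \<open>x\<close> and \<open>(x, False)\<close> for its formal inverse. A relation \<open>u = v\<close> is the pair \<open>(u, v)\<close>.\<close>

type_synonym 'g word = "('g \<times> bool) list"

definition words_over :: "'g set \<Rightarrow> 'g word set" where
  "words_over X = lists (X \<times> UNIV)"

definition inv_word :: "'g word \<Rightarrow> 'g word" where
  "inv_word w = rev (map (\<lambda>(x, b). (x, \<not> b)) w)"

inductive_set word_cong :: "'g set \<Rightarrow> ('g word \<times> 'g word) set \<Rightarrow> ('g word \<times> 'g word) set"
  for X :: "'g set" and R :: "('g word \<times> 'g word) set" where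
  rel: "(u, v) \<in> R \<Longrightarrow> u \<in> words_over X \<Longrightarrow> v \<in> words_over X \<Longrightarrow> (u, v) \<in> word_cong X R"
| cancel: "x \<in> X \<Longrightarrow> ([(x, b), (x, \<not> b)], []) \<in> word_cong X R"
| refl: "u \<in> words_over X \<Longrightarrow> (u, u) \<in> word_cong X R"
| sym: "(u, v) \<in> word_cong X R \<Longrightarrow> (v, u) \<in> word_cong X R"
| trans: "(u, v) \<in> word_cong X R \<Longrightarrow> (v, w) \<in> word_cong X R \<Longrightarrow> (u, w) \<in> word_cong X R"
| append: "(u, v) \<in> word_cong X R \<Longrightarrow> (u', v') \<in> word_cong X R \<Longrightarrow> (u @ u', v @ v') \<in> word_cong X R"

definition presented_group :: "'g set \<Rightarrow> ('g word \<times> 'g word) set \<Rightarrow> 'g word set monoid" where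
  "presented_group X R =
    \<lparr>carrier = words_over X // word_cong X R,
     monoid.mult = (\<lambda>A B. \<Union>u\<in>A. \<Union>v\<in>B. word_cong X R `` {u @ v}),
     one = word_cong X R `` {[]}\<rparr>"

lemma append_words_over: "u \<in> words_over X \<Longrightarrow> v \<in> words_over X \<Longrightarrow> u @ v \<in> words_over X"
  by (auto simp: words_over_def)

lemma word_cong_words: "(u, v) \<in> word_cong X R \<Longrightarrow> u \<in> words_over X \<and> v \<in> words_over X"
  by (induction rule: word_cong.induct) (auto simp: words_over_def)

lemma equiv_word_cong: "equiv (words_over X) (word_cong X R)"
proof (rule equivI)
  show "word_cong X R \<subseteq> words_over X \<times> words_over X"
    using word_cong_words by fastforce
  show "refl_on (words_over X) (word_cong X R)"
    by (auto simp: refl_on_def intro: word_cong.refl)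
  show "sym (word_cong X R)"
    by (auto simp: sym_def intro: word_cong.sym)
  show "trans (word_cong X R)"
    unfolding trans_def using word_cong.trans by blast
qed

lemma presented_group_mult:
  assumes "u \<in> words_over X" "v \<in> words_over X"
  shows "(word_cong X R `` {u}) \<otimes>\<^bsub>presented_group X R\<^esub> (word_cong X R `` {v}) = word_cong X R `` {u @ v}"
proof -
  have "congruent2 (word_cong X R) (word_cong X R) (\<lambda>u v. word_cong X R `` {u @ v})"
    by (rule congruent2I')
      (rule equiv_class_eq[OF equiv_word_cong], erule (1) word_cong.append)
  from UN_equiv_class2[OF equiv_word_cong equiv_word_cong this assms] show ?thesis
    by (simp add: presented_group_def)
qed

lemma inv_word_words_over: "u \<in> words_over X \<Longrightarrow> inv_word u \<in> words_over X"
  by (auto simp: words_over_def inv_word_def)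

lemma word_cong_inv_left: "u \<in> words_over X \<Longrightarrow> (inv_word u @ u, []) \<in> word_cong X R"
proof (induction u)
  case Nil
  then show ?case by (auto simp: inv_word_def words_over_def intro: word_cong.refl)
next
  case (Cons a u)
  obtain x b where a: "a = (x, b)" by (cases a)
  from Cons.prems have x: "x \<in> X" and u: "u \<in> words_over X"
    by (auto simp: a words_over_def)
  have "([(x, \<not> b), (x, b)] @ u, [] @ u) \<in> word_cong X R"
    using word_cong.append[OF word_cong.cancel[OF x, of "\<not> b"] word_cong.refl[OF u]] by simp
  then have "(inv_word u @ ([(x, \<not> b), (x, b)] @ u), inv_word u @ ([] @ u)) \<in> word_cong X R"
    by (rule word_cong.append[OF word_cong.refl[OF inv_word_words_over[OF u]]])
  with Cons.IH[OF u] show ?case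
    by (auto simp: a inv_word_def intro: word_cong.trans)
qed

lemma group_presented_group: "group (presented_group X R)"
proof (rule groupI)
  let ?G = "presented_group X R" and ?c = "\<lambda>u. word_cong X R `` {u}"
  have nil: "[] \<in> words_over X" by (simp add: words_over_def)
  have one: "\<one>\<^bsub>?G\<^esub> = ?c []" by (simp add: presented_group_def)
  have car: "carrier ?G = ?c ` words_over X" by (auto simp: presented_group_def quotient_def)
  show "\<one>\<^bsub>?G\<^esub> \<in> carrier ?G" using nil by (simp add: one car)
  show "x \<otimes>\<^bsub>?G\<^esub> y \<in> carrier ?G" if "x \<in> carrier ?G" "y \<in> carrier ?G" for x y
    using that by (auto simp: car presented_group_mult append_words_over)
  show "x \<otimes>\<^bsub>?G\<^esub> y \<otimes>\<^bsub>?G\<^esub> z = x \<otimes>\<^bsub>?G\<^esub> (y \<otimes>\<^bsub>?G\<^esub> z)"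
    if "x \<in> carrier ?G" "y \<in> carrier ?G" "z \<in> carrier ?G" for x y z
    using that by (auto simp: car presented_group_mult append_words_over)
  show "\<one>\<^bsub>?G\<^esub> \<otimes>\<^bsub>?G\<^esub> x = x" if "x \<in> carrier ?G" for x
    using that nil by (auto simp: car one presented_group_mult)
  show "\<exists>y\<in>carrier ?G. y \<otimes>\<^bsub>?G\<^esub> x = \<one>\<^bsub>?G\<^esub>" if "x \<in> carrier ?G" for x
  proof -
    from that obtain u where u: "u \<in> words_over X" and x: "x = ?c u" by (auto simp: car)
    have "?c (inv_word u) \<otimes>\<^bsub>?G\<^esub> x = \<one>\<^bsub>?G\<^esub>"
      by (simp add: x one presented_group_mult inv_word_words_over u
          equiv_class_eq[OF equiv_word_cong word_cong_inv_left])
    with u show ?thesis by (auto simp: car inv_word_words_over)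
  qed
qed


section \<open>The group of parenthesized braids\<close>

datatype braid_gen = Gen_sigma nat | Gen_a nat

abbreviation sg :: "nat \<Rightarrow> braid_gen \<times> bool" where "sg i \<equiv> (Gen_sigma i, True)"
abbreviation al :: "nat \<Rightarrow> braid_gen \<times> bool" where "al i \<equiv> (Gen_a i, True)"

definition B_bullet_gens :: "braid_gen set" where
  "B_bullet_gens = {Gen_sigma i |i. i \<ge> 1} \<union> {Gen_a i |i. i \<ge> 1}"

definition B_bullet_rels :: "(braid_gen word \<times> braid_gen word) set" where
  "B_bullet_rels =
      {([sg i, sg j], [sg j, sg i]) |i j. i \<ge> 1 \<and> j \<ge> i + 2}
    \<union> {([sg i, al j], [al j, sg i]) |i j. i \<ge> 1 \<and> j \<ge> i + 2}
    \<union> {([al i, al (j - 1)], [al j, al i]) |i j. i \<ge> 1 \<and> j \<ge> i + 2}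
    \<union> {([al i, sg (j - 1)], [sg j, al i]) |i j. i \<ge> 1 \<and> j \<ge> i + 2}
    \<union> {([sg i, sg (i + 1), sg i], [sg (i + 1), sg i, sg (i + 1)]) |i. i \<ge> 1}
    \<union> {([sg (i + 1), sg i, al (i + 1)], [al i, sg i]) |i. i \<ge> 1}
    \<union> {([sg i, sg (i + 1), al i], [al (i + 1), sg i]) |i. i \<ge> 1}"

lemma B_bullet_rels_words:
  "B_bullet_rels \<subseteq> words_over B_bullet_gens \<times> words_over B_bullet_gens"
  by (auto simp: B_bullet_rels_def B_bullet_gens_def words_over_def)

definition B_bullet :: "braid_gen word set monoid" where
  "B_bullet = presented_group B_bullet_gens B_bullet_rels"

lemma group_B_bullet: "group B_bullet"
  unfolding B_bullet_def by (rule group_presented_group)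


section \<open>Left-orderable groups\<close>

definition left_orderable :: "('a, 'm) monoid_scheme \<Rightarrow> bool" where
  "left_orderable G \<longleftrightarrow>
    (\<exists>r. linear_order_on (carrier G) r \<and>
      (\<forall>g\<in>carrier G. \<forall>x\<in>carrier G. \<forall>y\<in>carrier G.
        (x, y) \<in> r \<longrightarrow> (g \<otimes>\<^bsub>G\<^esub> x, g \<otimes>\<^bsub>G\<^esub> y) \<in> r))"


section \<open>Group algebras\<close>

text \<open>The library's multiplication on \<open>\<Rightarrow>\<^sub>0\<close> is the convolution for a type-class monoid of exponents;
  here the monoid is a record, so the convolution is defined explicitly.\<close>

definition convolution ::
  "('a, 'm) monoid_scheme \<Rightarrow> ('a \<Rightarrow>\<^sub>0 'k::comm_ring_1) \<Rightarrow> ('a \<Rightarrow>\<^sub>0 'k) \<Rightarrow> ('a \<Rightarrow>\<^sub>0 'k)" where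
  "convolution G f g =
    (\<Sum>x\<in>Poly_Mapping.keys f. \<Sum>y\<in>Poly_Mapping.keys g.
      Poly_Mapping.single (x \<otimes>\<^bsub>G\<^esub> y) (Poly_Mapping.lookup f x * Poly_Mapping.lookup g y))"

definition group_algebra :: "('a, 'm) monoid_scheme \<Rightarrow> ('a \<Rightarrow>\<^sub>0 'k::comm_ring_1) ring" where
  "group_algebra G =
    \<lparr>carrier = {f. Poly_Mapping.keys f \<subseteq> carrier G},
     monoid.mult = convolution G,
     one = Poly_Mapping.single \<one>\<^bsub>G\<^esub> 1,
     zero = 0,
     add = (+)\<rparr>"

definition has_no_zero_divisors :: "('a, 'm) ring_scheme \<Rightarrow> bool" where
  "has_no_zero_divisors R \<longleftrightarrow>
    (\<forall>x\<in>carrier R. \<forall>y\<in>carrier R. x \<otimes>\<^bsub>R\<^esub> y = \<zero>\<^bsub>R\<^esub> \<longrightarrow> x = \<zero>\<^bsub>R\<^esub> \<or> y = \<zero>\<^bsub>R\<^esub>)"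

lemma convolution_superset:
  assumes "finite A" "Poly_Mapping.keys f \<subseteq> A" "finite B" "Poly_Mapping.keys g \<subseteq> B"
  shows "convolution G f g = (\<Sum>x\<in>A. \<Sum>y\<in>B.
      Poly_Mapping.single (x \<otimes>\<^bsub>G\<^esub> y) (Poly_Mapping.lookup f x * Poly_Mapping.lookup g y))"
proof -
  have "(\<Sum>x\<in>A. \<Sum>y\<in>B. Poly_Mapping.single (x \<otimes>\<^bsub>G\<^esub> y) (Poly_Mapping.lookup f x * Poly_Mapping.lookup g y))
    = (\<Sum>x\<in>Poly_Mapping.keys f. \<Sum>y\<in>B.
        Poly_Mapping.single (x \<otimes>\<^bsub>G\<^esub> y) (Poly_Mapping.lookup f x * Poly_Mapping.lookup g y))"
    using assms by (intro sum.mono_neutral_right) (auto simp: in_keys_iff)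
  also have "\<dots> = convolution G f g"
    unfolding convolution_def using assms
    by (intro sum.cong sum.mono_neutral_right) (auto simp: in_keys_iff)
  finally show ?thesis by simp
qed

lemma convolution_add_left: "convolution G (f + f') g = convolution G f g + convolution G f' g"
proof -
  let ?A = "Poly_Mapping.keys f \<union> Poly_Mapping.keys f'"
  have A: "finite ?A" "Poly_Mapping.keys (f + f') \<subseteq> ?A" by (simp_all add: Poly_Mapping.keys_add)
  show ?thesis
    using A by (simp add: convolution_superset[of ?A _ "Poly_Mapping.keys g"]
        lookup_add distrib_right single_add sum.distrib)
qed

lemma convolution_add_right: "convolution G f (g + g') = convolution G f g + convolution G f g'"
proof -
  let ?B = "Poly_Mapping.keys g \<union> Poly_Mapping.keys g'"
  have B: "finite ?B" "Poly_Mapping.keys (g + g') \<subseteq> ?B" by (simp_all add: Poly_Mapping.keys_add)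
  show ?thesis
    using B by (simp add: convolution_superset[of "Poly_Mapping.keys f" _ ?B]
        lookup_add distrib_left single_add sum.distrib)
qed

lemma convolution_zero [simp]: "convolution G 0 g = 0" "convolution G f 0 = 0"
  by (simp_all add: convolution_def)

lemma convolution_sum_left: "convolution G (sum F I) g = (\<Sum>i\<in>I. convolution G (F i) g)"
  by (induction I rule: infinite_finite_induct) (simp_all add: convolution_add_left)

lemma convolution_sum_right: "convolution G f (sum F I) = (\<Sum>i\<in>I. convolution G f (F i))"
  by (induction I rule: infinite_finite_induct) (simp_all add: convolution_add_right)

lemma convolution_single:
  "convolution G (Poly_Mapping.single x a) (Poly_Mapping.single y b) = Poly_Mapping.single (x \<otimes>\<^bsub>G\<^esub> y) (a * b)"
  by (simp add: convolution_superset[of "{x}" _ "{y}"])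

lemma poly_mapping_eq_sum_single:
  "f = (\<Sum>x\<in>Poly_Mapping.keys f. Poly_Mapping.single x (Poly_Mapping.lookup f x))"
  by (rule poly_mapping_eqI)
    (auto simp: lookup_sum lookup_single when_def in_keys_iff)

lemma keys_convolution:
  assumes "group G" "Poly_Mapping.keys f \<subseteq> carrier G" "Poly_Mapping.keys g \<subseteq> carrier G"
  shows "Poly_Mapping.keys (convolution G f g) \<subseteq> carrier G"
proof -
  interpret group G by fact
  show ?thesis
    unfolding convolution_def using assms(2,3)
    by (intro order.trans[OF keys_sum] UN_least) (auto split: if_splits)
qed

lemma convolution_assoc:
  assumes "group G" "Poly_Mapping.keys f \<subseteq> carrier G" "Poly_Mapping.keys g \<subseteq> carrier G"
    "Poly_Mapping.keys h \<subseteq> carrier G"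
  shows "convolution G (convolution G f g) h = convolution G f (convolution G g h)"
proof -
  interpret group G by fact
  let ?s = "\<lambda>f x. Poly_Mapping.single x (Poly_Mapping.lookup f x)"
  have "convolution G (convolution G (\<Sum>x\<in>Poly_Mapping.keys f. ?s f x) (\<Sum>y\<in>Poly_Mapping.keys g. ?s g y))
      (\<Sum>z\<in>Poly_Mapping.keys h. ?s h z)
    = convolution G (\<Sum>x\<in>Poly_Mapping.keys f. ?s f x)
      (convolution G (\<Sum>y\<in>Poly_Mapping.keys g. ?s g y) (\<Sum>z\<in>Poly_Mapping.keys h. ?s h z))"
    unfolding convolution_sum_left convolution_sum_right convolution_single
    using assms(2-4) by (intro sum.cong) (auto simp: m_assoc mult.assoc subset_iff)
  then show ?thesis by (simp flip: poly_mapping_eq_sum_single)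
qed

lemma convolution_one:
  assumes "group G" "Poly_Mapping.keys f \<subseteq> carrier G"
  shows "convolution G (Poly_Mapping.single \<one>\<^bsub>G\<^esub> 1) f = f" "convolution G f (Poly_Mapping.single \<one>\<^bsub>G\<^esub> 1) = f"
proof -
  interpret group G by fact
  let ?s = "\<lambda>x. Poly_Mapping.single x (Poly_Mapping.lookup f x)" and ?e = "Poly_Mapping.single \<one>\<^bsub>G\<^esub> 1"
  have "convolution G ?e (\<Sum>x\<in>Poly_Mapping.keys f. ?s x) = (\<Sum>x\<in>Poly_Mapping.keys f. ?s x)"
    unfolding convolution_sum_right convolution_single
    using assms(2) by (intro sum.cong) auto
  then show "convolution G ?e f = f" by (simp flip: poly_mapping_eq_sum_single)
  have "convolution G (\<Sum>x\<in>Poly_Mapping.keys f. ?s x) ?e = (\<Sum>x\<in>Poly_Mapping.keys f. ?s x)"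
    unfolding convolution_sum_left convolution_single
    using assms(2) by (intro sum.cong) auto
  then show "convolution G f ?e = f" by (simp flip: poly_mapping_eq_sum_single)
qed

lemma ring_group_algebra:
  assumes "group G"
  shows "ring (group_algebra G :: ('a \<Rightarrow>\<^sub>0 'k::comm_ring_1) ring)"
proof (rule ringI)
  interpret group G by fact
  let ?R = "group_algebra G :: ('a \<Rightarrow>\<^sub>0 'k) ring"
  show "abelian_group ?R"
  proof (rule abelian_groupI)
    show "x \<oplus>\<^bsub>?R\<^esub> y \<in> carrier ?R" if "x \<in> carrier ?R" "y \<in> carrier ?R" for x y
      using that Poly_Mapping.keys_add[of x y] by (auto simp: group_algebra_def)
    show "\<exists>y\<in>carrier ?R. y \<oplus>\<^bsub>?R\<^esub> x = \<zero>\<^bsub>?R\<^esub>" if "x \<in> carrier ?R" for x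
      using that by (intro bexI[of _ "- x"]) (auto simp: group_algebra_def in_keys_iff subset_iff)
  qed (auto simp: group_algebra_def algebra_simps)
  show "Group.monoid ?R"
    by (rule monoidI)
      (use assms in \<open>auto simp: group_algebra_def convolution_one convolution_assoc split: if_splits
        dest: subsetD[OF keys_convolution, rotated 3]\<close>)
qed (auto simp: group_algebra_def convolution_add_left convolution_add_right)

end

theory Submission
  imports Defs "HOL-Library.Countable"
begin

text \<open>Every element of the group has the form \<open>- f + b + h\<close> with \<open>b\<close> a braid and \<open>f\<close>, \<open>h\<close> products of
  generators \<open>a i\<close>. It is declared positive if \<open>b\<close> is sigma-positive for Dehornoy's braid
  ordering, or if \<open>b = 0\<close> and \<open>- f + h\<close>, acting on the rationals by piecewise linear increasing
  maps, moves the first non-fixed rational (in some enumeration) to the right. Moving a generator \<open>a i\<close>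
  across a braid doubles a strand, which preserves sigma-positivity; hence positive elements form a
  semigroup.

  Every braid is trivial, sigma-positive or sigma-negative: braids carry the left self-distributive
  operation \<open>u + sh v + s 0 - sh u\<close>, a positive braid is a product of iterated shifts of elements of the
  substructure generated by \<open>0\<close>, and in a self-distributive structure with one generator any two
  elements are comparable for iterated left division, by confluence of the self-distributivity law.
  No sigma-positive braid is trivial, by Larue's argument: an Artin automorphism preserves the set of
  reduced words that start with a given negative letter. To make this apply to the presented group, the
  Artin representation is extended to the generators \<open>a i\<close> by letting it act on sequences of
  free-group-valued labels that can be split indefinitely.\<close>

section \<open>The group of parenthesized braids as an additive group type\<close>

text \<open>As a type of class \<open>group_add\<close>, which does not assume commutativity, the
  group gets its laws as simplifier rules in additive notation.\<close>

typedef pb = "carrier B_bullet"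
  using group.is_monoid[OF group_B_bullet] monoid.one_closed by blast

instantiation pb :: group_add
begin

definition "0 = Abs_pb \<one>\<^bsub>B_bullet\<^esub>"
definition "u + v = Abs_pb (Rep_pb u \<otimes>\<^bsub>B_bullet\<^esub> Rep_pb v)"
definition "- u = Abs_pb (inv\<^bsub>B_bullet\<^esub> Rep_pb u)"
definition "u - v = u + - (v :: pb)"

instance
proof
  interpret group B_bullet by (rule group_B_bullet)
  fix u v w :: pb
  note [simp] = Abs_pb_inverse Rep_pb Rep_pb_inverse
  show "u + v + w = u + (v + w)"
    by (simp add: plus_pb_def m_assoc)
  show "0 + u = u" "u + 0 = u"
    by (simp_all add: plus_pb_def zero_pb_def)
  show "- u + u = 0"
    by (simp add: plus_pb_def uminus_pb_def zero_pb_def)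
  show "u + - v = u - v"
    by (simp add: minus_pb_def)
qed

end

lemma Rep_pb_plus: "Rep_pb (u + v) = Rep_pb u \<otimes>\<^bsub>B_bullet\<^esub> Rep_pb v"
proof -
  interpret group B_bullet by (rule group_B_bullet)
  show ?thesis by (simp add: plus_pb_def Abs_pb_inverse Rep_pb)
qed

abbreviation wcong :: "(braid_gen word \<times> braid_gen word) set" where
  "wcong \<equiv> word_cong B_bullet_gens B_bullet_rels"

definition cls :: "braid_gen word \<Rightarrow> pb" where
  "cls w = Abs_pb (wcong `` {w})"

lemma Rep_pb_cls: "w \<in> words_over B_bullet_gens \<Longrightarrow> Rep_pb (cls w) = wcong `` {w}"
  unfolding cls_def
  by (rule Abs_pb_inverse) (auto simp: B_bullet_def presented_group_def intro: quotientI)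

lemma cls_append:
  assumes "v \<in> words_over B_bullet_gens" "w \<in> words_over B_bullet_gens"
  shows "cls (v @ w) = cls v + cls w"
proof -
  have "Rep_pb (cls (v @ w)) = Rep_pb (cls v + cls w)"
    using assms presented_group_mult[OF assms, of B_bullet_rels]
    by (simp add: Rep_pb_plus Rep_pb_cls append_words_over B_bullet_def)
  then show ?thesis by (simp add: Rep_pb_inject)
qed

lemma cls_Nil: "cls [] = 0"
  by (simp add: cls_def zero_pb_def B_bullet_def presented_group_def)

lemma cls_eqI: "(v, w) \<in> wcong \<Longrightarrow> cls v = cls w"
  unfolding cls_def by (drule equiv_class_eq[OF equiv_word_cong]) simp

lemma pb_cls_cases:
  obtains w where "w \<in> words_over B_bullet_gens" "u = cls w"
proof -
  have "Rep_pb u \<in> carrier B_bullet" by (rule Rep_pb)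
  then obtain w where w: "w \<in> words_over B_bullet_gens" "Rep_pb u = wcong `` {w}"
    by (auto simp: B_bullet_def presented_group_def elim: quotientE)
  then have "u = cls w" using Rep_pb_inverse[of u] by (simp add: cls_def)
  with w(1) show thesis by (rule that)
qed

lemma cls_eq_iff:
  assumes "v \<in> words_over B_bullet_gens" "w \<in> words_over B_bullet_gens"
  shows "cls v = cls w \<longleftrightarrow> (v, w) \<in> wcong"
  using assms eq_equiv_class_iff[OF equiv_word_cong assms, of B_bullet_rels]
  by (metis Rep_pb_cls Rep_pb_inject)

text \<open>Generators are indexed from 0 here, so the side condition \<open>i \<ge> 1\<close> disappears.\<close>

definition s :: "nat \<Rightarrow> pb" where "s i = cls [sg (Suc i)]"
definition a :: "nat \<Rightarrow> pb" where "a i = cls [al (Suc i)]"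

lemma gens_words:
  "Gen_sigma (Suc i) \<in> B_bullet_gens" "Gen_a (Suc i) \<in> B_bullet_gens"
  "[] \<in> words_over B_bullet_gens"
  "l # w \<in> words_over B_bullet_gens \<longleftrightarrow> fst l \<in> B_bullet_gens \<and> w \<in> words_over B_bullet_gens"
  by (cases l; auto simp: B_bullet_gens_def words_over_def)+

lemma cls_Cons:
  "l # w \<in> words_over B_bullet_gens \<Longrightarrow> w \<noteq> [] \<Longrightarrow> cls (l # w) = cls [l] + cls w"
  using cls_append[of "[l]" w] by (simp add: gens_words)

lemma cls_rel:
  "(v, w) \<in> B_bullet_rels \<Longrightarrow> cls v = cls w"
  using B_bullet_rels_words by (intro cls_eqI word_cong.rel) auto

lemma cls_inverse: "fst l \<in> B_bullet_gens \<Longrightarrow> cls [(fst l, \<not> snd l)] = - cls [l]"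
proof -
  assume l: "fst l \<in> B_bullet_gens"
  have "cls [l] + cls [(fst l, \<not> snd l)] = cls ([l] @ [(fst l, \<not> snd l)])"
    by (rule cls_append[symmetric]) (use l in \<open>auto simp: gens_words\<close>)
  also have "\<dots> = 0"
    using cls_eqI[OF word_cong.cancel[OF l, of "snd l"]] by (simp add: cls_Nil)
  finally show ?thesis by (simp add: minus_unique)
qed

lemma pb_rels:
  shows s_s: "i + 2 \<le> j \<Longrightarrow> s i + s j = s j + s i"
    and s_a: "i + 2 \<le> j \<Longrightarrow> s i + a j = a j + s i"
    and a_a: "i < j \<Longrightarrow> a i + a j = a (Suc j) + a i"
    and a_s: "i < j \<Longrightarrow> a i + s j = s (Suc j) + a i"
    and braid: "s i + (s (Suc i) + s i) = s (Suc i) + (s i + s (Suc i))"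
    and s_s_a: "s (Suc i) + (s i + a (Suc i)) = a i + s i"
    and s_s_a': "s i + (s (Suc i) + a i) = a (Suc i) + s i"
proof -
  note r = cls_rel[unfolded B_bullet_rels_def]
  note [simp] = s_def a_def gens_words cls_Cons[symmetric]
  show "s i + s j = s j + s i" if "i + 2 \<le> j"
    using that by (simp, intro r) auto
  show "s i + a j = a j + s i" if "i + 2 \<le> j"
    using that by (simp, intro r) auto
  show "a i + a j = a (Suc j) + a i" if "i < j"
    using that by (simp, intro r) force
  show "a i + s j = s (Suc j) + a i" if "i < j"
    using that by (simp, intro r) force
  show "s i + (s (Suc i) + s i) = s (Suc i) + (s i + s (Suc i))"
    by (simp, intro r) force
  show "s (Suc i) + (s i + a (Suc i)) = a i + s i"
    by (simp, intro r) force
  show "s i + (s (Suc i) + a i) = a (Suc i) + s i"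
    by (simp, intro r) force
qed

lemma pb_induct [case_names zero s ms a ma]:
  assumes "Q 0"
    and "\<And>i u. Q u \<Longrightarrow> Q (s i + u)" "\<And>i u. Q u \<Longrightarrow> Q (- s i + u)"
    and "\<And>i u. Q u \<Longrightarrow> Q (a i + u)" "\<And>i u. Q u \<Longrightarrow> Q (- a i + u)"
  shows "Q u"
proof -
  have "Q (cls w)" if "w \<in> words_over B_bullet_gens" for w
    using that
  proof (induction w)
    case Nil
    then show ?case using assms(1) by (simp add: cls_Nil)
  next
    case (Cons l w)
    then have w: "w \<in> words_over B_bullet_gens" and IH: "Q (cls w)" and l: "fst l \<in> B_bullet_gens"
      by (auto simp: gens_words)
    have *: "cls (l # w) = cls [l] + cls w"
      using cls_append[of "[l]" w] w l by (simp add: gens_words)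
    from l consider i where "fst l = Gen_sigma (Suc i)" | i where "fst l = Gen_a (Suc i)"
      by (auto simp: B_bullet_gens_def dest!: Suc_le_D)
    then show ?case
    proof cases
      case 1
      then have "cls [l] = s i \<or> cls [l] = - s i"
        using cls_inverse[of "(fst l, True)"] l by (cases l; cases "snd l") (auto simp: s_def)
      then show ?thesis using * assms(2,3) IH by auto
    next
      case 2
      then have "cls [l] = a i \<or> cls [l] = - a i"
        using cls_inverse[of "(fst l, True)"] l by (cases l; cases "snd l") (auto simp: a_def)
      then show ?thesis using * assms(4,5) IH by auto
    qed
  qed
  then show ?thesis by (metis pb_cls_cases)
qed

text \<open>The universal property of the presentation: bijections of a set that satisfy the
  defining relations define a left action of the group. It yields the shift endomorphism, the action
  on labels and the action on the rationals.\<close>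

locale pb_action =
  fixes S S' A A' :: "nat \<Rightarrow> 'x \<Rightarrow> 'x"
  assumes S_inv: "S i (S' i x) = x" "S' i (S i x) = x"
    and A_inv: "A i (A' i x) = x" "A' i (A i x) = x"
    and S_S: "i + 2 \<le> j \<Longrightarrow> S i (S j x) = S j (S i x)"
    and S_A: "i + 2 \<le> j \<Longrightarrow> S i (A j x) = A j (S i x)"
    and A_A: "i < j \<Longrightarrow> A i (A j x) = A (Suc j) (A i x)"
    and A_S: "i < j \<Longrightarrow> A i (S j x) = S (Suc j) (A i x)"
    and S_braid: "S i (S (Suc i) (S i x)) = S (Suc i) (S i (S (Suc i) x))"
    and S_S_A: "S (Suc i) (S i (A (Suc i) x)) = A i (S i x)"
    and S_S_A': "S i (S (Suc i) (A i x)) = A (Suc i) (S i x)"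
begin

definition letter :: "braid_gen \<times> bool \<Rightarrow> 'x \<Rightarrow> 'x" where
  "letter l = (case l of
      (Gen_sigma i, b) \<Rightarrow> if b then S (i - 1) else S' (i - 1)
    | (Gen_a i, b) \<Rightarrow> if b then A (i - 1) else A' (i - 1))"

lemma foldr_letter_rel:
  assumes "(v, w) \<in> B_bullet_rels"
  shows "foldr letter v = foldr letter w"
proof -
  note [simp] = fun_eq_iff letter_def
  have "foldr letter [sg i, sg j] = foldr letter [sg j, sg i]"
    "foldr letter [sg i, al j] = foldr letter [al j, sg i]"
    "foldr letter [al i, al (j - 1)] = foldr letter [al j, al i]"
    "foldr letter [al i, sg (j - 1)] = foldr letter [sg j, al i]"
    if "1 \<le> i" "i + 2 \<le> j" for i j
  proof -
    from that obtain i' j' where "i = Suc i'" "j = Suc (Suc j')" "i' < j'"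
      by (cases i; cases j; cases "j - 1") auto
    then show "foldr letter [sg i, sg j] = foldr letter [sg j, sg i]"
      "foldr letter [sg i, al j] = foldr letter [al j, sg i]"
      "foldr letter [al i, al (j - 1)] = foldr letter [al j, al i]"
      "foldr letter [al i, sg (j - 1)] = foldr letter [sg j, al i]"
      by (auto simp: S_A A_A A_S intro: S_S)
  qed
  moreover have "foldr letter [sg i, sg (i + 1), sg i] = foldr letter [sg (i + 1), sg i, sg (i + 1)]"
    "foldr letter [sg (i + 1), sg i, al (i + 1)] = foldr letter [al i, sg i]"
    "foldr letter [sg i, sg (i + 1), al i] = foldr letter [al (i + 1), sg i]"
    if "1 \<le> i" for i
    using that by (cases i; simp add: S_braid S_S_A S_S_A')+
  ultimately show ?thesis
    using assms unfolding B_bullet_rels_def by blast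
qed

lemma foldr_letter_cong: "(v, w) \<in> wcong \<Longrightarrow> foldr letter v = foldr letter w"
proof (induction rule: word_cong.induct)
  case (cancel x b)
  then show ?case
    by (auto simp: fun_eq_iff letter_def S_inv A_inv split: braid_gen.split)
qed (auto simp: foldr_letter_rel)

definition act :: "pb \<Rightarrow> 'x \<Rightarrow> 'x" where
  "act u = foldr letter (SOME w. w \<in> words_over B_bullet_gens \<and> u = cls w)"

lemma act_cls:
  assumes "w \<in> words_over B_bullet_gens"
  shows "act (cls w) = foldr letter w"
proof -
  define v where "v = (SOME v. v \<in> words_over B_bullet_gens \<and> cls w = cls v)"
  have "v \<in> words_over B_bullet_gens \<and> cls w = cls v"
    unfolding v_def by (rule someI_ex) (use assms in blast)
  then have "foldr letter w = foldr letter v"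
    by (intro foldr_letter_cong) (metis assms cls_eq_iff)
  then show ?thesis by (simp add: act_def v_def)
qed

lemma act_plus [simp]: "act (u + v) x = act u (act v x)"
proof -
  obtain w w' where "w \<in> words_over B_bullet_gens" "u = cls w"
    "w' \<in> words_over B_bullet_gens" "v = cls w'"
    by (metis pb_cls_cases)
  then show ?thesis by (simp add: append_words_over act_cls flip: cls_append)
qed

lemma act_zero [simp]: "act 0 x = x"
  using act_cls[of "[]"] by (simp add: cls_Nil gens_words)

lemma act_minus_cancel [simp]: "act u (act (- u) x) = x" "act (- u) (act u x) = x"
  by (simp_all flip: act_plus)

lemma act_s [simp]: "act (s i) = S i" and act_a [simp]: "act (a i) = A i"
  using act_cls by (simp_all add: s_def a_def gens_words letter_def fun_eq_iff)

lemma act_ms [simp]: "act (- s i) = S' i" and act_ma [simp]: "act (- a i) = A' i"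
proof -
  show "act (- s i) = S' i"
    by (rule ext) (metis S_inv(1) act_minus_cancel(2) act_s)
  show "act (- a i) = A' i"
    by (rule ext) (metis A_inv(1) act_minus_cancel(2) act_a)
qed

end

section \<open>The shift endomorphism\<close>

text \<open>The shifted generators satisfy the relations again, so left multiplication by them is an
  action; the orbit of \<open>0\<close> gives the endomorphism.\<close>

interpretation sh: pb_action
  "\<lambda>i u. s (Suc i) + u" "\<lambda>i u. - s (Suc i) + u" "\<lambda>i u. a (Suc i) + u" "\<lambda>i u. - a (Suc i) + u"
proof (unfold_locales, goal_cases)
  case (5 i j x)
  then show ?case by (simp add: s_s[of "Suc i" "Suc j"] flip: add.assoc)
next
  case (9 i x)
  then show ?case using braid[of "Suc i"] by (metis add.assoc)
next
  case (10 i x)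
  then show ?case using s_s_a[of "Suc i"] by (metis add.assoc)
next
  case (11 i x)
  then show ?case using s_s_a'[of "Suc i"] by (metis add.assoc)
qed (simp_all add: s_a a_a a_s flip: add.assoc)

definition sh :: "pb \<Rightarrow> pb" where "sh u = sh.act u 0"

lemma sh_act: "sh.act u x = sh u + x"
  unfolding sh_def by (induction u rule: pb_induct) (simp_all add: add.assoc)

lemma sh_plus [simp]: "sh (u + v) = sh u + sh v"
  by (metis sh_act sh.act_plus sh_def)

lemma sh_zero [simp]: "sh 0 = 0"
  by (simp add: sh_def)

lemma sh_minus [simp]: "sh (- u) = - sh u"
  by (metis sh_plus sh_zero add.left_inverse minus_unique add.right_inverse)

lemma sh_diff [simp]: "sh (u - v) = sh u - sh v"
  by (metis sh_plus sh_minus add_uminus_conv_diff)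

lemma sh_s [simp]: "sh (s i) = s (Suc i)" and sh_a [simp]: "sh (a i) = a (Suc i)"
  by (simp_all add: sh_def)

section \<open>Braids and sigma-positive braids\<close>

inductive_set braids :: "nat \<Rightarrow> pb set" for k where
  zero [simp, intro]: "0 \<in> braids k"
| plus_s: "u \<in> braids k \<Longrightarrow> k \<le> j \<Longrightarrow> u + s j \<in> braids k"
| minus_s: "u \<in> braids k \<Longrightarrow> k \<le> j \<Longrightarrow> u - s j \<in> braids k"

lemma braids_s [simp, intro]: "k \<le> j \<Longrightarrow> s j \<in> braids k"
  using braids.plus_s[OF braids.zero] by simp

lemma braids_plus [intro]: "u \<in> braids k \<Longrightarrow> v \<in> braids k \<Longrightarrow> u + v \<in> braids k"
  by (rotate_tac, induction rule: braids.induct)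
    (auto intro: braids.intros simp: add_diff_eq simp flip: add.assoc)

lemma braids_minus [intro]: "u \<in> braids k \<Longrightarrow> - u \<in> braids k"
proof (induction rule: braids.induct)
  case (plus_s u j)
  then show ?case
    using braids_plus[OF braids.minus_s[OF braids.zero, of k j], of "- u"] by (simp add: minus_add)
next
  case (minus_s u j)
  then show ?case
    using braids_plus[OF braids_s[of k j], of "- u"] by simp
qed simp

lemma braids_diff [intro]: "u \<in> braids k \<Longrightarrow> v \<in> braids k \<Longrightarrow> u - v \<in> braids k"
  using braids_plus[of u k "- v"] by auto

lemma braids_mono: "u \<in> braids k \<Longrightarrow> l \<le> k \<Longrightarrow> u \<in> braids l"
  by (induction rule: braids.induct) (auto intro: braids.intros)

lemma sh_braids [intro]: "u \<in> braids k \<Longrightarrow> sh u \<in> braids (Suc k)"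
  by (induction rule: braids.induct) (auto intro: braids.intros)

text \<open>Dehornoy's sigma-positivity with main index \<open>k\<close>: some expression contains
  \<open>s k\<close>, but neither \<open>- s k\<close> nor a letter of smaller index. The rule
  \<open>start\<close> covers the prefix up to the first \<open>s k\<close>.\<close>

inductive_set spos :: "nat \<Rightarrow> pb set" for k where
  start: "u \<in> braids (Suc k) \<Longrightarrow> u + s k \<in> spos k"
| plus_s: "u \<in> spos k \<Longrightarrow> k \<le> j \<Longrightarrow> u + s j \<in> spos k"
| minus_s: "u \<in> spos k \<Longrightarrow> k < j \<Longrightarrow> u - s j \<in> spos k"

lemma spos_s [simp, intro]: "s k \<in> spos k"
  using spos.start[OF braids.zero] by simp

lemma spos_braids: "u \<in> spos k \<Longrightarrow> u \<in> braids k"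
proof (induction rule: spos.induct)
  case (start u)
  then show ?case using braids_mono[of u "Suc k" k] by (auto intro: braids.plus_s)
qed (auto intro: braids.intros)

lemma spos_plus_braids [intro]: "v \<in> braids (Suc k) \<Longrightarrow> u \<in> spos k \<Longrightarrow> u + v \<in> spos k"
  by (induction rule: braids.induct)
    (auto intro: spos.intros simp: add_diff_eq simp flip: add.assoc)

lemma braids_plus_spos [intro]: "u \<in> spos k \<Longrightarrow> v \<in> braids (Suc k) \<Longrightarrow> v + u \<in> spos k"
proof (induction rule: spos.induct)
  case (start u)
  then show ?case using spos.start[of "v + u" k] by (auto simp: add.assoc)
qed (auto intro: spos.intros simp: add_diff_eq simp flip: add.assoc)

lemma spos_plus: "v \<in> spos k \<Longrightarrow> u \<in> spos k \<Longrightarrow> u + v \<in> spos k"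
proof (induction rule: spos.induct)
  case (start v)
  then show ?case using spos.plus_s[of "u + v" k k] by (auto simp: add.assoc)
qed (auto intro: spos.intros simp: add_diff_eq simp flip: add.assoc)

lemma sh_spos [intro]: "u \<in> spos k \<Longrightarrow> sh u \<in> spos (Suc k)"
  by (induction rule: spos.induct) (auto intro: spos.intros)

definition sigma_pos :: "pb set" where "sigma_pos = (\<Union>k. spos k)"

lemma sigma_posI [intro]: "u \<in> spos k \<Longrightarrow> u \<in> sigma_pos"
  by (auto simp: sigma_pos_def)

lemma sigma_pos_braids: "u \<in> sigma_pos \<Longrightarrow> u \<in> braids 0"
  by (auto simp: sigma_pos_def intro: spos_braids braids_mono)

text \<open>The smaller main index decides: the other factor only uses letters above it and is
  absorbed.\<close>

lemma sigma_pos_plus: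
  assumes "u \<in> sigma_pos" "v \<in> sigma_pos"
  shows "u + v \<in> sigma_pos"
proof -
  from assms obtain k l where kl: "u \<in> spos k" "v \<in> spos l"
    by (auto simp: sigma_pos_def)
  consider "k < l" | "k = l" | "l < k" by linarith
  then show ?thesis
  proof cases
    case 1
    then have "v \<in> braids (Suc k)" using kl spos_braids braids_mono by (metis Suc_leI)
    with kl show ?thesis by blast
  next
    case 2
    with kl show ?thesis using spos_plus by blast
  next
    case 3
    then have "u \<in> braids (Suc l)" using kl spos_braids braids_mono by (metis Suc_leI)
    with kl show ?thesis by blast
  qed
qed

lemma sh_sigma_pos: "u \<in> sigma_pos \<Longrightarrow> sh u \<in> sigma_pos"
  by (auto simp: sigma_pos_def)

section \<open>Terms modulo left self-distributivity\<close>

datatype lterm = Var | App lterm lterm (infixl \<open>\<cdot>\<close> 70)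

text \<open>The law is used in the expanding direction only; this oriented relation is the confluent
  one.\<close>

inductive ldexp :: "lterm \<Rightarrow> lterm \<Rightarrow> bool" where
  refl [simp, intro]: "ldexp t t"
| trans [trans]: "ldexp t u \<Longrightarrow> ldexp u v \<Longrightarrow> ldexp t v"
| app [intro]: "ldexp t t' \<Longrightarrow> ldexp u u' \<Longrightarrow> ldexp (t \<cdot> u) (t' \<cdot> u')"
| distrib: "ldexp (t \<cdot> (u \<cdot> v)) ((t \<cdot> u) \<cdot> (t \<cdot> v))"

primrec distr :: "lterm \<Rightarrow> lterm \<Rightarrow> lterm" where
  "distr t Var = t \<cdot> Var"
| "distr t (u \<cdot> v) = distr t u \<cdot> distr t v"

text \<open>Dehornoy's operator: \<open>full t\<close> is a common expansion of all one-step expansions of \<open>t\<close>,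
  which makes its iterates witnesses of confluence.\<close>

primrec full :: "lterm \<Rightarrow> lterm" where
  "full Var = Var"
| "full (t \<cdot> u) = distr (full t) (full u)"

lemma ldexp_distr: "ldexp (t \<cdot> u) (distr t u)"
proof (induction u)
  case (App u v)
  then show ?case by (auto intro: ldexp.trans[OF ldexp.distrib])
qed simp

lemma distr_mono_right: "ldexp u u' \<Longrightarrow> ldexp (distr t u) (distr t u')"
  by (induction rule: ldexp.induct) (auto intro: ldexp.intros)

lemma distr_mono: "ldexp t t' \<Longrightarrow> ldexp u u' \<Longrightarrow> ldexp (distr t u) (distr t' u')"
proof -
  assume t: "ldexp t t'" and u: "ldexp u u'"
  have "ldexp (distr t u) (distr t' u)"
    by (induction u) (use t in auto)
  with u show ?thesis by (blast intro: ldexp.trans distr_mono_right)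
qed

text \<open>At each leaf of \<open>v\<close>, one use of the law creates the factor
  \<open>distr t u \<cdot> t\<close>, which \<open>ldexp_distr\<close> expands. This is the case of
  a single use of the law in \<open>full_mono\<close>.\<close>

lemma distr_distr: "ldexp (distr t (distr u v)) (distr (distr t u) (distr t v))"
proof (induction v)
  case Var
  have "ldexp (distr t u \<cdot> (t \<cdot> Var)) ((distr t u \<cdot> t) \<cdot> (distr t u \<cdot> Var))"
    by (rule ldexp.distrib)
  also have "ldexp \<dots> (distr (distr t u) t \<cdot> (distr t u \<cdot> Var))"
    by (auto intro: ldexp_distr)
  finally show ?case by simp
qed auto

text \<open>The law carries both factors down to the leaves of \<open>v\<close>, where
  \<open>t \<cdot> u\<close> only has to be expanded to \<open>distr t u\<close>. Thus one
  application of \<open>full\<close> covers a use of the law at the root.\<close>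

lemma ldexp_distrib_distr: "ldexp ((t \<cdot> u) \<cdot> (t \<cdot> v)) (distr t (distr u v))"
proof (induction v)
  case Var
  show ?case by (auto intro: ldexp_distr)
next
  case (App v w)
  have "ldexp ((t \<cdot> u) \<cdot> (t \<cdot> (v \<cdot> w))) ((t \<cdot> u) \<cdot> ((t \<cdot> v) \<cdot> (t \<cdot> w)))"
    by (auto intro: ldexp.distrib)
  also have "ldexp \<dots> (((t \<cdot> u) \<cdot> (t \<cdot> v)) \<cdot> ((t \<cdot> u) \<cdot> (t \<cdot> w)))"
    by (rule ldexp.distrib)
  also have "ldexp \<dots> (distr t (distr u v) \<cdot> distr t (distr u w))"
    using App by auto
  finally show ?case by simp
qed

lemma ldexp_full: "ldexp t (full t)"
  by (induction t) (auto intro: ldexp.trans[OF _ ldexp_distr])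

lemma full_mono: "ldexp t t' \<Longrightarrow> ldexp (full t) (full t')"
  by (induction rule: ldexp.induct) (auto intro: ldexp.trans distr_mono distr_distr)

lemma full_pow_mono: "ldexp t t' \<Longrightarrow> ldexp ((full ^^ k) t) ((full ^^ k) t')"
  by (induction k) (auto intro: full_mono)

lemma ldexp_full_pow: "ldexp u ((full ^^ k) t) \<Longrightarrow> k \<le> l \<Longrightarrow> ldexp u ((full ^^ l) t)"
  by (rotate_tac, induction rule: dec_induct) (auto intro: ldexp.trans[OF _ ldexp_full])

lemma full_pow_app: "ldexp ((full ^^ k) t \<cdot> (full ^^ k) u) ((full ^^ k) (t \<cdot> u))"
proof (induction k)
  case (Suc k)
  have "ldexp ((full ^^ Suc k) t \<cdot> (full ^^ Suc k) u) (full ((full ^^ k) t \<cdot> (full ^^ k) u))"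
    by (auto intro: ldexp_distr)
  also have "ldexp \<dots> ((full ^^ Suc k) (t \<cdot> u))"
    using full_mono[OF Suc] by simp
  finally show ?case .
qed simp

text \<open>Each use of the law costs one application of \<open>full\<close>; transitivity adds the
  counts, and congruence takes their maximum.\<close>

lemma ldexp_full_pow_ex: "ldexp t t' \<Longrightarrow> \<exists>k. ldexp t' ((full ^^ k) t)"
proof (induction rule: ldexp.induct)
  case (refl t)
  show ?case by (auto intro: exI[of _ 0])
next
  case (trans t u v)
  then obtain k l where "ldexp u ((full ^^ k) t)" "ldexp v ((full ^^ l) u)" by blast
  then have "ldexp v ((full ^^ l) ((full ^^ k) t))"
    by (blast intro: ldexp.trans full_pow_mono)
  then show ?case by (auto simp flip: funpow_add comp_apply[of "full ^^ _"])
next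
  case (app t t' u u')
  then obtain k l where "ldexp t' ((full ^^ k) t)" "ldexp u' ((full ^^ l) u)" by blast
  then have "ldexp t' ((full ^^ max k l) t)" "ldexp u' ((full ^^ max k l) u)"
    using ldexp_full_pow[of _ _ _ "max k l"] by auto
  then have "ldexp (t' \<cdot> u') ((full ^^ max k l) (t \<cdot> u))"
    by (blast intro: ldexp.trans full_pow_app)
  then show ?case by blast
next
  case (distrib t u v)
  have "ldexp ((t \<cdot> u) \<cdot> (t \<cdot> v)) ((full t \<cdot> full u) \<cdot> (full t \<cdot> full v))"
    by (auto intro: ldexp_full)
  also have "ldexp \<dots> ((full ^^ 1) (t \<cdot> (u \<cdot> v)))"
    using ldexp_distrib_distr by simp
  finally show ?case by blast
qed

theorem ldexp_confluent:
  assumes "ldexp t u" "ldexp t v"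
  obtains w where "ldexp u w" "ldexp v w"
proof -
  obtain k l where "ldexp u ((full ^^ k) t)" "ldexp v ((full ^^ l) t)"
    using assms[THEN ldexp_full_pow_ex] by (elim exE)
  then show thesis
    using that[OF ldexp_full_pow ldexp_full_pow, of k t "max k l" l] by simp
qed

definition ldeq :: "lterm \<Rightarrow> lterm \<Rightarrow> bool" where
  "ldeq t u \<longleftrightarrow> (\<exists>w. ldexp t w \<and> ldexp u w)"

lemma ldeq_refl: "ldeq t t"
  by (auto simp: ldeq_def)

lemma ldeq_sym: "ldeq t u \<Longrightarrow> ldeq u t"
  by (auto simp: ldeq_def)

lemma ldeq_trans [trans]:
  assumes "ldeq t u" "ldeq u v"
  shows "ldeq t v"
proof -
  from assms obtain w w' where w: "ldexp t w" "ldexp u w" "ldexp u w'" "ldexp v w'"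
    by (auto simp: ldeq_def)
  from w(2,3) obtain z where "ldexp w z" "ldexp w' z" by (rule ldexp_confluent)
  with w show ?thesis unfolding ldeq_def by (blast intro: ldexp.trans)
qed

lemma ldeq_app: "ldeq t t' \<Longrightarrow> ldeq u u' \<Longrightarrow> ldeq (t \<cdot> u) (t' \<cdot> u')"
  by (auto simp: ldeq_def)

lemma ldeq_distrib: "ldeq (t \<cdot> (u \<cdot> v)) ((t \<cdot> u) \<cdot> (t \<cdot> v))"
  unfolding ldeq_def by (blast intro: ldexp.distrib)

section \<open>Right powers and absorption\<close>

definition rpow :: "nat \<Rightarrow> lterm" where "rpow n = ((\<cdot>) Var ^^ n) Var"

lemma rpow_Suc: "rpow (Suc n) = Var \<cdot> rpow n"
  by (simp add: rpow_def)

text \<open>Once \<open>rpow (Suc m)\<close> is exchanged for \<open>t \<cdot> rpow m\<close>, the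
  law folds \<open>(t \<cdot> u) \<cdot> (t \<cdot> rpow m)\<close> back to
  \<open>t \<cdot> (u \<cdot> rpow m)\<close>, and the induction hypotheses absorb \<open>u\<close>
  and then \<open>t\<close>. Hence any two terms become equivalent after multiplication by a long
  right power.\<close>

lemma absorption: "\<exists>N. \<forall>n\<ge>N. ldeq (t \<cdot> rpow n) (rpow (Suc n))"
proof (induction t)
  case Var
  show ?case by (simp add: rpow_Suc ldeq_refl)
next
  case (App t u)
  then obtain N N' where N: "\<And>n. n \<ge> N \<Longrightarrow> ldeq (t \<cdot> rpow n) (rpow (Suc n))"
    and N': "\<And>n. n \<ge> N' \<Longrightarrow> ldeq (u \<cdot> rpow n) (rpow (Suc n))" by blast
  have "ldeq ((t \<cdot> u) \<cdot> rpow n) (rpow (Suc n))" if "n \<ge> Suc (max N N')" for n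
  proof -
    from that obtain m where m: "n = Suc m" "m \<ge> N" "m \<ge> N'"
      by (metis Suc_le_D Suc_le_mono max.bounded_iff)
    have "ldeq ((t \<cdot> u) \<cdot> rpow n) ((t \<cdot> u) \<cdot> (t \<cdot> rpow m))"
      using m N by (auto intro: ldeq_app ldeq_refl ldeq_sym)
    also have "ldeq \<dots> (t \<cdot> (u \<cdot> rpow m))"
      by (rule ldeq_sym[OF ldeq_distrib])
    also have "ldeq \<dots> (t \<cdot> rpow (Suc m))"
      using m N' by (auto intro: ldeq_app ldeq_refl)
    also have "ldeq \<dots> (rpow (Suc n))"
      using m N[of "Suc m"] by simp
    finally show ?thesis .
  qed
  then show ?case by blast
qed

section \<open>The self-distributive operation on braids\<close>

lemmas group_add_normal = add.assoc diff_conv_add_uminus minus_add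

lemma commute_minus: "u + v = v + u \<Longrightarrow> u + - v = - v + (u :: 'a :: group_add)"
  by (metis add.assoc add.right_neutral add_minus_cancel left_minus minus_add_cancel)

lemma commute_plus:
  "w + u = u + w \<Longrightarrow> w + v = v + w \<Longrightarrow> w + (u + v) = (u + v) + (w :: 'a :: group_add)"
  by (metis add.assoc)

text \<open>A double shift only involves generators of index at least 2, and these commute with
  \<open>s 0\<close>.\<close>

lemma s0_sh_sh: "s 0 + sh (sh u) = sh (sh u) + s 0"
proof (induction u rule: pb_induct)
  case (s i u)
  have "s 0 + s (Suc (Suc i)) = s (Suc (Suc i)) + s 0" by (rule s_s) simp
  with s show ?case by (simp only: sh_plus sh_s commute_plus)
next
  case (ms i u)
  have "s 0 + - s (Suc (Suc i)) = - s (Suc (Suc i)) + s 0" by (rule commute_minus[OF s_s]) simp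
  with ms show ?case by (simp only: sh_plus sh_minus sh_s commute_plus)
next
  case (a i u)
  have "s 0 + a (Suc (Suc i)) = a (Suc (Suc i)) + s 0" by (rule s_a) simp
  with a show ?case by (simp only: sh_plus sh_a commute_plus)
next
  case (ma i u)
  have "s 0 + - a (Suc (Suc i)) = - a (Suc (Suc i)) + s 0" by (rule commute_minus[OF s_a]) simp
  with ma show ?case by (simp only: sh_plus sh_minus sh_a commute_plus)
qed simp

definition ld :: "pb \<Rightarrow> pb \<Rightarrow> pb" (infixr \<open>\<star>\<close> 70) where
  "u \<star> v = u + sh v + s 0 - sh u"

text \<open>Doubly shifted factors pass through \<open>s 0\<close> and cancel; what remains is the
  braid relation between \<open>s 0\<close> and \<open>s (Suc 0)\<close>.\<close>

lemma ld_distrib: "u \<star> (v \<star> w) = (u \<star> v) \<star> (u \<star> w)"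
proof -
  note [simp] = group_add_normal
  note [simp del] = add_uminus_conv_diff
  define u2 v2 w2 where "u2 = sh (sh u)" "v2 = sh (sh v)" "w2 = sh (sh w)"
  have c: "- u2 + (s 0 + (u2 + x)) = s 0 + x" "s 0 + (w2 + x) = w2 + (s 0 + x)"
    "s 0 + (- v2 + x) = - v2 + (s 0 + x)" for x
    using s0_sh_sh[of u] s0_sh_sh[of w] s0_sh_sh[of "- v"]
    by (simp_all add: u2_v2_w2_def) (metis add.assoc minus_add_cancel)+
  have b: "s 0 + (s (Suc 0) + (s 0 + (- s (Suc 0) + x))) = s (Suc 0) + (s 0 + x)" for x
    using braid[of 0] by (metis add.assoc add_minus_cancel)
  show ?thesis
    by (simp add: ld_def c b flip: u2_v2_w2_def)
qed

lemma braids_ld [intro]: "u \<in> braids 0 \<Longrightarrow> v \<in> braids 0 \<Longrightarrow> u \<star> v \<in> braids 0"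
  unfolding ld_def by (meson braids_diff braids_mono braids_plus braids_s le0 sh_braids)

primrec evl :: "lterm \<Rightarrow> pb" where
  "evl Var = 0"
| "evl (t \<cdot> u) = evl t \<star> evl u"

lemma evl_braids [simp, intro]: "evl t \<in> braids 0"
  by (induction t) auto

definition ldless :: "pb \<Rightarrow> pb \<Rightarrow> bool" where
  "ldless = (\<lambda>u v. \<exists>w \<in> braids 0. v = u \<star> w)\<^sup>+\<^sup>+"

lemma ldlessI: "w \<in> braids 0 \<Longrightarrow> ldless u (u \<star> w)"
  unfolding ldless_def by blast

lemma ldless_trans: "ldless u v \<Longrightarrow> ldless v w \<Longrightarrow> ldless u w"
  unfolding ldless_def by (rule tranclp_trans)

text \<open>By the law, left translation by \<open>w\<close> turns a division with quotient
  \<open>x\<close> into one with quotient \<open>w \<star> x\<close>.\<close>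

lemma ldless_ld:
  assumes "ldless u v" "w \<in> braids 0"
  shows "ldless (w \<star> u) (w \<star> v)"
proof -
  have step: "ldless (w \<star> v) (w \<star> (v \<star> x))" if "x \<in> braids 0" for v x
    by (subst ld_distrib) (use that assms(2) in \<open>blast intro: ldlessI\<close>)
  from assms(1)[unfolded ldless_def] show ?thesis
    by (induction rule: tranclp_induct) (blast intro: step ldless_trans)+
qed

text \<open>One division step from \<open>v\<close> to \<open>v \<star> w\<close> appends
  \<open>sh w + s 0 - sh v\<close>, whose only letter of index 0 is a positive
  \<open>s 0\<close>.\<close>

lemma ldless_spos:
  assumes "ldless u v" "u \<in> braids 0"
  shows "- u + v \<in> spos 0"
proof -
  have spos_diff: "sh w + s 0 - sh v \<in> spos 0" if "v \<in> braids 0" "w \<in> braids 0" for v w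
    using that spos_plus_braids[of "- sh v" 0 "sh w + s 0"] by auto
  from assms(1) show ?thesis
    unfolding ldless_def
  proof (induction rule: tranclp_induct)
    case (base v)
    then obtain w where "w \<in> braids 0" "v = u \<star> w" by auto
    then show ?case
      using spos_diff[OF assms(2)] by (simp add: ld_def add.assoc add_diff_eq)
  next
    case (step v v')
    then obtain w where w: "w \<in> braids 0" "v' = v \<star> w" by auto
    have v: "v \<in> braids 0"
      using braids_plus[OF assms(2) spos_braids[OF step.IH]] by (simp flip: add.assoc)
    have "- u + v' = (- u + v) + (sh w + s 0 - sh v)"
      by (simp add: w ld_def add.assoc add_diff_eq)
    with spos_plus[OF spos_diff[OF v w(1)] step.IH] show ?case by simp
  qed
qed

text \<open>Every expansion of a term keeps the values of its cuts, and these form a chain. Comparing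
  two elements thus only requires terms with a common expansion that cut to both of them.\<close>

primrec cuts :: "lterm \<Rightarrow> pb set" where
  "cuts Var = {0}"
| "cuts (t \<cdot> u) = cuts t \<union> (\<star>) (evl t) ` cuts u"

lemma cuts_braids: "c \<in> cuts t \<Longrightarrow> c \<in> braids 0"
  by (induction t arbitrary: c) auto

lemma evl_cuts [simp]: "evl t \<in> cuts t"
  by (induction t) auto

lemma cuts_le_evl: "c \<in> cuts t \<Longrightarrow> c = evl t \<or> ldless c (evl t)"
proof (induction t arbitrary: c)
  case (App t u)
  from App.prems consider "c \<in> cuts t" | c' where "c' \<in> cuts u" "c = evl t \<star> c'"
    unfolding cuts.simps by blast
  then show ?case
  proof cases
    case 1
    have "ldless (evl t) (evl (t \<cdot> u))" by (simp add: ldlessI)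
    then show ?thesis using App.IH(1)[OF 1] by (metis ldless_trans)
  next
    case 2
    then show ?thesis using App.IH(2)[OF 2(1)] ldless_ld[OF _ evl_braids, of c' "evl u" t]
      unfolding 2(2) evl.simps by metis
  qed
qed simp

lemma cuts_chain: "c \<in> cuts t \<Longrightarrow> d \<in> cuts t \<Longrightarrow> c = d \<or> ldless c d \<or> ldless d c"
proof (induction t arbitrary: c d)
  case (App t u)
  \<comment> \<open>A cut of \<open>t\<close> is at most \<open>evl t\<close>, and
    \<open>evl t\<close> left-divides every cut that comes from \<open>u\<close>.\<close>
  have less: "ldless c (evl t \<star> d)" if "c \<in> cuts t" "d \<in> cuts u" for c d
    using ldlessI[OF cuts_braids[OF that(2)], of "evl t"] cuts_le_evl[OF that(1)]
    by (metis ldless_trans)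
  from App.prems consider "c \<in> cuts t" "d \<in> cuts t"
    | d' where "c \<in> cuts t" "d' \<in> cuts u" "d = evl t \<star> d'"
    | c' where "c' \<in> cuts u" "c = evl t \<star> c'" "d \<in> cuts t"
    | c' d' where "c' \<in> cuts u" "c = evl t \<star> c'" "d' \<in> cuts u" "d = evl t \<star> d'"
    unfolding cuts.simps by blast
  then show ?case
  proof cases
    case 1
    then show ?thesis by (rule App.IH)
  next
    case 2
    then show ?thesis using less by blast
  next
    case 3
    then show ?thesis using less by blast
  next
    case 4
    from App.IH(2)[OF 4(1,3)] show ?thesis
    proof (elim disjE)
      assume "c' = d'"
      then show ?thesis by (simp add: 4(2,4))
    next
      assume "ldless c' d'"
      then show ?thesis using ldless_ld[OF _ evl_braids] by (simp add: 4(2,4))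
    next
      assume "ldless d' c'"
      then show ?thesis using ldless_ld[OF _ evl_braids] by (simp add: 4(2,4))
    qed
  qed
qed simp

lemma ldexp_cuts: "ldexp t t' \<Longrightarrow> evl t = evl t' \<and> cuts t \<subseteq> cuts t'"
proof (induction rule: ldexp.induct)
  case (distrib t u v)
  \<comment> \<open>The cuts inherited from \<open>v\<close> agree by the law; the expanded term
    merely adds translates of the cuts of \<open>t\<close>.\<close>
  have "(\<star>) (evl t \<star> evl u) ` (\<star>) (evl t) ` cuts v = (\<star>) (evl t) ` (\<star>) (evl u) ` cuts v"
    by (simp add: image_image flip: ld_distrib)
  then show ?case by (auto simp flip: ld_distrib)
qed auto

text \<open>Multiplied by a long right power both terms become equivalent, so both values are cuts
  of one common expansion.\<close>

theorem evl_comparable: "evl t = evl u \<or> ldless (evl t) (evl u) \<or> ldless (evl u) (evl t)"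
proof -
  obtain M N where "\<And>n. n \<ge> M \<Longrightarrow> ldeq (t \<cdot> rpow n) (rpow (Suc n))"
    "\<And>n. n \<ge> N \<Longrightarrow> ldeq (u \<cdot> rpow n) (rpow (Suc n))"
    using absorption by metis
  then have "ldeq (t \<cdot> rpow (max M N)) (u \<cdot> rpow (max M N))"
    by (meson ldeq_trans ldeq_sym max.cobounded1 max.cobounded2)
  then obtain w where w: "ldexp (t \<cdot> rpow (max M N)) w" "ldexp (u \<cdot> rpow (max M N)) w"
    by (auto simp: ldeq_def)
  have "evl t \<in> cuts w" "evl u \<in> cuts w"
    using w[THEN ldexp_cuts] by auto
  then show ?thesis by (rule cuts_chain)
qed

section \<open>Every braid is trivial, sigma-positive or sigma-negative\<close>

inductive_set pos_braids :: "pb set" where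
  zero [simp, intro]: "0 \<in> pos_braids"
| plus_s: "u \<in> pos_braids \<Longrightarrow> u + s i \<in> pos_braids"

lemma pos_braids_s [simp, intro]: "s i \<in> pos_braids"
  using pos_braids.plus_s[OF pos_braids.zero] by simp

lemma pos_braids_plus [intro]: "v \<in> pos_braids \<Longrightarrow> u \<in> pos_braids \<Longrightarrow> u + v \<in> pos_braids"
  by (induction rule: pos_braids.induct) (auto intro: pos_braids.intros simp flip: add.assoc)

lemma sh_pos_braids [intro]: "u \<in> pos_braids \<Longrightarrow> sh u \<in> pos_braids"
  by (induction rule: pos_braids.induct) auto

text \<open>\<open>dlt n\<close> is Garside's fundamental braid on \<open>n + 1\<close> strands.\<close>

primrec srow :: "nat \<Rightarrow> pb" where
  "srow 0 = 0"
| "srow (Suc n) = srow n + s n"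

primrec dlt :: "nat \<Rightarrow> pb" where
  "dlt 0 = 0"
| "dlt (Suc n) = srow (Suc n) + dlt n"

lemma srow_pos [intro, simp]: "srow n \<in> pos_braids"
  by (induction n) auto

lemma dlt_pos [intro, simp]: "dlt n \<in> pos_braids"
  by (induction n) (auto simp del: srow.simps)

lemma srow_commute: "n < i \<Longrightarrow> srow n + s i = s i + srow n"
proof (induction n)
  case (Suc n)
  then have "s i + srow n = srow n + s i" "s i + s n = s n + s i"
    using s_s[of n i] by simp_all
  then show ?case by (simp only: srow.simps commute_plus)
qed simp

lemma dlt_commute: "n < i \<Longrightarrow> dlt n + s i = s i + dlt n"
proof (induction n)
  case (Suc n)
  then have "s i + dlt n = dlt n + s i" "s i + srow (Suc n) = srow (Suc n) + s i"
    using srow_commute[of "Suc n" i] by simp_all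
  then show ?case by (simp only: dlt.simps commute_plus)
qed simp

lemma srow_s: "Suc i < n \<Longrightarrow> srow n + s i = s (Suc i) + srow n"
proof (induction n)
  case (Suc n)
  show ?case
  proof (cases "Suc i < n")
    case True
    then show ?thesis using Suc s_s[of i n] by simp (metis add.assoc)
  next
    case False
    then have n: "n = Suc i" using Suc by simp
    have "srow (Suc n) + s i = srow i + (s i + (s (Suc i) + s i))"
      by (simp add: n add.assoc)
    also have "\<dots> = (srow i + s (Suc i)) + (s i + s (Suc i))"
      by (simp add: braid add.assoc)
    also have "\<dots> = s (Suc i) + srow (Suc n)"
      by (simp add: srow_commute n add.assoc)
    finally show ?thesis .
  qed
qed simp

lemma srow_srow: "m < n \<Longrightarrow> srow n + srow m = sh (srow m) + srow n"
proof (induction m)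
  case (Suc m)
  then show ?case using srow_s[of m n] by simp (metis add.assoc)
qed simp

lemma srow_Suc_sh: "srow (Suc n) = s 0 + sh (srow n)"
proof (induction n)
  case (Suc n)
  have "srow (Suc (Suc n)) = (s 0 + sh (srow n)) + s (Suc n)"
    unfolding srow.simps(2)[of "Suc n"] Suc ..
  then show ?case by (simp add: add.assoc)
qed simp

text \<open>Conjugation by the fundamental braid flips the strands. Below the top index, the flip of
  the shorter braid is corrected by the first row, which raises indices by one. At the top index,
  \<open>s m\<close> completes the second row to a copy of the first, from which \<open>s 0\<close>
  splits off.\<close>

lemma dlt_s: "i < n \<Longrightarrow> dlt n + s i = s (n - 1 - i) + dlt n"
proof (induction n arbitrary: i)
  case (Suc m)
  consider "i < m" | "i = m" "m = 0" | k where "i = m" "m = Suc k"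
    using Suc.prems by (cases m) (auto simp: less_Suc_eq)
  then show ?case
  proof cases
    case 1
    have "dlt (Suc m) + s i = srow (Suc m) + (s (m - 1 - i) + dlt m)"
      using Suc.IH[OF 1] by (simp add: add.assoc)
    also have "\<dots> = s (Suc (m - 1 - i)) + srow (Suc m) + dlt m"
      using srow_s[of "m - 1 - i" "Suc m"] 1 by (metis add.assoc diff_less_Suc less_Suc_eq_0_disj Suc_diff_Suc Suc_less_eq diff_Suc_1 diff_diff_left plus_1_eq_Suc)
    finally show ?thesis using 1 by (simp add: add.assoc Suc_diff_Suc)
  next
    case 2
    then show ?thesis by simp
  next
    case 3
    have "dlt (Suc m) + s i = srow (Suc m) + (srow m + (dlt k + s m))"
      by (simp add: 3 add.assoc del: srow.simps)
    also have "\<dots> = srow (Suc m) + (srow (Suc m) + dlt k)"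
      using dlt_commute[of k m] by (simp add: 3 add.assoc)
    also have "\<dots> = s 0 + (sh (srow m) + srow (Suc m)) + dlt k"
      by (subst srow_Suc_sh) (simp add: add.assoc del: srow.simps)
    also have "\<dots> = s 0 + (srow (Suc m) + srow m) + dlt k"
      using srow_srow[of m "Suc m"] by simp
    also have "\<dots> = s (Suc m - 1 - i) + dlt (Suc m)"
      by (simp add: 3 add.assoc del: srow.simps)
    finally show ?thesis .
  qed
qed simp

text \<open>For the top index: \<open>dlt (Suc m)\<close> begins with \<open>s 0\<close>, and
  \<open>dlt_s\<close> lets that letter reappear at the other end as \<open>s m\<close>.\<close>

lemma dlt_divisible: "i < n \<Longrightarrow> \<exists>p \<in> pos_braids. dlt n = p + s i"
proof (induction n)
  case (Suc m)
  show ?case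
  proof (cases "i < m")
    case True
    then obtain p where "p \<in> pos_braids" "dlt m = p + s i" using Suc.IH by blast
    then show ?thesis
      by (intro bexI[of _ "srow (Suc m) + p"]) (auto simp: add.assoc)
  next
    case False
    with Suc.prems have i: "i = m" by simp
    let ?p = "sh (srow m) + dlt m"
    have p: "dlt (Suc m) = s 0 + ?p"
      unfolding dlt.simps by (subst srow_Suc_sh) (simp add: add.assoc)
    have "s 0 + dlt (Suc m) = s 0 + (?p + s m)"
      using dlt_s[of m "Suc m"] p by (metis add.assoc diff_Suc_1 diff_self_eq_0 lessI)
    then have "dlt (Suc m) = ?p + s i" using i by (metis add_left_cancel)
    then show ?thesis by blast
  qed
qed simp

lemma dlt_pos_braid:
  "u \<in> pos_braids \<Longrightarrow> \<exists>N. \<forall>n\<ge>N. \<exists>v \<in> pos_braids. dlt n + u = v + dlt n"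
proof (induction rule: pos_braids.induct)
  case (plus_s u i)
  then obtain N where N: "\<And>n. n \<ge> N \<Longrightarrow> \<exists>v \<in> pos_braids. dlt n + u = v + dlt n" by blast
  have "\<exists>v \<in> pos_braids. dlt n + (u + s i) = v + dlt n" if "n \<ge> max N (Suc i)" for n
  proof -
    from that N obtain v where "v \<in> pos_braids" "dlt n + u = v + dlt n" by auto
    then have "v + s (n - 1 - i) \<in> pos_braids" "dlt n + (u + s i) = v + s (n - 1 - i) + dlt n"
      using dlt_s[of i n] that by (auto simp: add.assoc simp flip: add.assoc[of _ u] intro: pos_braids.intros)
    then show ?thesis by blast
  qed
  then show ?case by blast
next
  case zero
  show ?case by (intro exI[of _ 0] allI impI bexI[of _ 0]) auto
qed

text \<open>A negative letter on the right is completed to the inverse of a large fundamental braid,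
  which ends with that letter and can be moved to the left across the positive part.\<close>

theorem braids_fraction: "u \<in> braids 0 \<Longrightarrow> \<exists>p\<in>pos_braids. \<exists>q\<in>pos_braids. u = - p + q"
proof (induction rule: braids.induct)
  case zero
  show ?case by (auto intro!: bexI[of _ 0])
next
  case (plus_s u j)
  then show ?case by (metis add.assoc pos_braids.plus_s)
next
  case (minus_s u j)
  then obtain p q where pq: "p \<in> pos_braids" "q \<in> pos_braids" "u = - p + q" by blast
  from dlt_pos_braid[OF pq(2)] obtain N where "\<And>n. n \<ge> N \<Longrightarrow> \<exists>v \<in> pos_braids. dlt n + q = v + dlt n" by blast
  then obtain n q' where n: "j < n" "q' \<in> pos_braids" "dlt n + q = q' + dlt n"
    by (metis le_add1 less_add_Suc2 add_Suc_right)
  from dlt_divisible[OF n(1)] obtain p' where p': "p' \<in> pos_braids" "dlt n = p' + s j" by blast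
  have "u - s j = - (dlt n + p) + (q' + p')"
  proof -
    have "q = - dlt n + (q' + dlt n)" using n(3) by (metis minus_add_cancel)
    then have "u = - p + (- dlt n + (q' + (p' + s j)))" using pq(3) p'(2) by metis
    then show ?thesis by (simp add: group_add_normal del: add_uminus_conv_diff)
  qed
  then show ?case using pq n p' by blast
qed

section \<open>Positive braids as products of iterated shifts\<close>

primrec prod_sh :: "pb list \<Rightarrow> pb" where
  "prod_sh [] = 0"
| "prod_sh (u # us) = u + sh (prod_sh us)"

lemma prod_sh_replicate [simp]: "prod_sh (replicate n 0) = 0"
  by (induction n) auto

text \<open>This is the braid action on sequences with entries in a self-distributive structure:
  neighbours \<open>u\<close>, \<open>v\<close> at positions \<open>i\<close>, \<open>i + 1\<close>
  become \<open>u \<star> v\<close>, \<open>u\<close>. The entries behind them are doubly shifted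
  relative to position \<open>i\<close> and do not interfere with the crossing.\<close>

lemma prod_sh_s:
  "i + 2 \<le> length us \<Longrightarrow> set us \<subseteq> range evl \<Longrightarrow>
    \<exists>vs. length vs = length us \<and> set vs \<subseteq> range evl \<and> prod_sh us + s i = prod_sh vs"
proof (induction us arbitrary: i)
  case (Cons u us)
  show ?case
  proof (cases i)
    case 0
    with Cons.prems obtain v ws where us: "us = v # ws" by (cases us) auto
    from Cons.prems us obtain t t' where t: "u = evl t" "v = evl t'" by auto
    have "prod_sh (u # us) + s i = prod_sh ((u \<star> v) # u # ws)"
      using s0_sh_sh[of "prod_sh ws"]
      by (simp add: us 0 ld_def group_add_normal del: add_uminus_conv_diff)
    moreover have "u \<star> v \<in> range evl" unfolding t by (metis evl.simps(2) rangeI)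
    ultimately show ?thesis
      using Cons.prems by (intro exI[of _ "(u \<star> v) # u # ws"]) (auto simp: us)
  next
    case (Suc j)
    with Cons obtain vs where "length vs = length us" "set vs \<subseteq> range evl" "prod_sh us + s j = prod_sh vs"
      by force
    moreover from this have "prod_sh (u # us) + s i = prod_sh (u # vs)"
      by (simp add: Suc add.assoc flip: sh_s sh_plus)
    ultimately show ?thesis
      using Cons.prems by (intro exI[of _ "u # vs"]) auto
  qed
qed simp

lemma pos_braids_prod_sh:
  "u \<in> pos_braids \<Longrightarrow> \<exists>N. \<forall>n\<ge>N. \<exists>us. length us = n \<and> set us \<subseteq> range evl \<and> u = prod_sh us"
proof (induction rule: pos_braids.induct)
  case zero
  have "\<exists>us. length us = n \<and> set us \<subseteq> range evl \<and> 0 = prod_sh us" for n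
    by (intro exI[of _ "replicate n 0"]) (auto intro: range_eqI[of _ _ Var])
  then show ?case by blast
next
  case (plus_s u i)
  then obtain N where N: "\<And>n. n \<ge> N \<Longrightarrow> \<exists>us. length us = n \<and> set us \<subseteq> range evl \<and> u = prod_sh us"
    by blast
  have "\<exists>us. length us = n \<and> set us \<subseteq> range evl \<and> u + s i = prod_sh us" if "n \<ge> max N (i + 2)" for n
    using N[of n] prod_sh_s that by (metis max.bounded_iff)
  then show ?case by blast
qed

text \<open>The first position at which the sequences differ decides. Equal heads cancel and leave a
  shift; at different heads \<open>ldless\<close> gives a sigma-positive difference that absorbs the
  shifted tails.\<close>

lemma prod_sh_compare:
  assumes "length us = length vs" "set us \<subseteq> range evl" "set vs \<subseteq> range evl"
  shows "prod_sh us = prod_sh vs \<or> - prod_sh us + prod_sh vs \<in> sigma_pos \<or>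
    - prod_sh vs + prod_sh us \<in> sigma_pos"
  using assms
proof (induction us vs rule: list_induct2)
  case (Cons u us v vs)
  have br: "prod_sh us \<in> braids 0" if "set us \<subseteq> range evl" for us
    using that by (induction us) (auto intro: braids_mono)
  have less: "- prod_sh (u # us) + prod_sh (v # vs) \<in> sigma_pos"
    if "ldless u v" "u \<in> braids 0" "set us \<subseteq> range evl" "set vs \<subseteq> range evl" for u v us vs
  proof -
    have "- sh (prod_sh us) + ((- u + v) + sh (prod_sh vs)) \<in> spos 0"
      using ldless_spos[of u v] that br[of us] br[of vs] by blast
    then show ?thesis by (auto simp: group_add_normal simp del: add_uminus_conv_diff)
  qed
  from Cons.prems obtain t t' where t: "u = evl t" "v = evl t'" by auto
  consider "u = v" | "ldless u v" | "ldless v u"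
    using evl_comparable[of t t'] by (auto simp: t)
  then show ?case
  proof cases
    case 1
    have *: "- prod_sh (v # us) + prod_sh (v # vs) = sh (- prod_sh us + prod_sh vs)" for us vs
      by (simp add: group_add_normal del: add_uminus_conv_diff)
    have "prod_sh us = prod_sh vs \<or> - prod_sh us + prod_sh vs \<in> sigma_pos \<or>
        - prod_sh vs + prod_sh us \<in> sigma_pos"
      using Cons by simp
    then show ?thesis unfolding 1 * by (metis sh_sigma_pos prod_sh.simps(2))
  next
    case 2
    then show ?thesis using less[of u v us vs] Cons.prems t by auto
  next
    case 3
    then show ?thesis using less[of v u vs us] Cons.prems t by auto
  qed
qed simp

theorem braids_trichotomy:
  assumes "u \<in> braids 0"
  shows "u = 0 \<or> u \<in> sigma_pos \<or> - u \<in> sigma_pos"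
proof -
  from braids_fraction[OF assms] obtain p q where pq: "p \<in> pos_braids" "q \<in> pos_braids" "u = - p + q"
    by blast
  obtain M N where MN: "\<And>n. n \<ge> M \<Longrightarrow> \<exists>us. length us = n \<and> set us \<subseteq> range evl \<and> p = prod_sh us"
    "\<And>n. n \<ge> N \<Longrightarrow> \<exists>us. length us = n \<and> set us \<subseteq> range evl \<and> q = prod_sh us"
    using pos_braids_prod_sh[OF pq(1)] pos_braids_prod_sh[OF pq(2)] by blast
  obtain us where us: "length us = max M N" "set us \<subseteq> range evl" "p = prod_sh us"
    using MN(1)[of "max M N"] by auto
  obtain vs where vs: "length vs = max M N" "set vs \<subseteq> range evl" "q = prod_sh vs"
    using MN(2)[of "max M N"] by auto
  show ?thesis using prod_sh_compare[of us vs] us vs by (auto simp: pq(3) minus_add)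
qed

section \<open>The free group on countably many generators\<close>

definition inv_letter :: "nat \<times> bool \<Rightarrow> nat \<times> bool" where
  "inv_letter l = (fst l, \<not> snd l)"

lemma inv_letter_simps [simp]:
  "inv_letter (k, b) = (k, \<not> b)" "inv_letter (inv_letter l) = l"
  "inv_letter l \<noteq> l" "l \<noteq> inv_letter l"
  by (cases l; simp add: inv_letter_def)+

fun reduced :: "(nat \<times> bool) list \<Rightarrow> bool" where
  "reduced (l # m # w) \<longleftrightarrow> m \<noteq> inv_letter l \<and> reduced (m # w)"
| "reduced _ \<longleftrightarrow> True"

lemma reduced_Cons: "reduced (l # w) \<longleftrightarrow> reduced w \<and> (w = [] \<or> hd w \<noteq> inv_letter l)"
  by (cases w) auto

definition push :: "nat \<times> bool \<Rightarrow> (nat \<times> bool) list \<Rightarrow> (nat \<times> bool) list" where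
  "push l w = (if w \<noteq> [] \<and> hd w = inv_letter l then tl w else l # w)"

lemma reduced_push [simp]: "reduced w \<Longrightarrow> reduced (push l w)"
  by (cases w) (auto simp: push_def reduced_Cons)

lemma push_push [simp]: "reduced w \<Longrightarrow> push l (push (inv_letter l) w) = w"
  by (cases w; cases "tl w") (auto simp: push_def reduced_Cons)

lemma reduced_foldr_push [simp]: "reduced w \<Longrightarrow> reduced (foldr push v w)"
  by (induction v) auto

lemma foldr_push_push:
  "reduced v \<Longrightarrow> reduced w \<Longrightarrow> foldr push (push l v) w = push l (foldr push v w)"
proof (cases v)
  case (Cons m u)
  assume "reduced v" "reduced w"
  then show ?thesis
    using push_push[of "foldr push u w" l] by (auto simp: Cons push_def[of l "m # u"])
qed (simp add: push_def)

lemma foldr_push_foldr: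
  "reduced v \<Longrightarrow> reduced w \<Longrightarrow> foldr push (foldr push u v) w = foldr push u (foldr push v w)"
  by (induction u) (simp_all add: foldr_push_push)

lemma foldr_push_Nil [simp]: "reduced w \<Longrightarrow> foldr push w [] = w"
  by (induction w) (auto simp: push_def reduced_Cons)

lemma foldr_push_rev [simp]: "reduced w \<Longrightarrow> foldr push (rev (map inv_letter v)) (foldr push v w) = w"
proof (induction v arbitrary: w)
  case (Cons l v)
  then show ?case using push_push[of "foldr push v w" "inv_letter l"] by simp
qed simp

typedef fg = "{w. reduced w}"
  by (intro exI[of _ "[]"]) simp

setup_lifting type_definition_fg

instantiation fg :: group_add
begin

lift_definition zero_fg :: fg is "[]" by simp
lift_definition plus_fg :: "fg \<Rightarrow> fg \<Rightarrow> fg" is "foldr push" by simp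
lift_definition uminus_fg :: "fg \<Rightarrow> fg" is "\<lambda>w. foldr push (rev (map inv_letter w)) []" by simp
definition "u - v = u + - (v :: fg)"

instance
proof
  fix u v w :: fg
  show "u + v + w = u + (v + w)" by transfer (simp add: foldr_push_foldr)
  show "0 + u = u" "u + 0 = u" by (transfer; simp)+
  show "- u + u = 0"
  proof transfer
    fix w :: "(nat \<times> bool) list"
    assume w: "reduced w"
    let ?v = "rev (map inv_letter w)"
    have "foldr push (foldr push ?v []) w = foldr push ?v (foldr push [] w)"
      using w by (intro foldr_push_foldr) simp_all
    also have "\<dots> = foldr push ?v (foldr push w [])" using w by simp
    finally show "foldr push (foldr push ?v []) w = []" by (simp only: foldr_push_rev reduced.simps)
  qed
  show "u + - v = u - v" by (simp add: minus_fg_def)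
qed

end

lift_definition gen :: "nat \<times> bool \<Rightarrow> fg" is "\<lambda>l. [l]" by simp

definition gval :: "(nat \<Rightarrow> fg) \<Rightarrow> nat \<times> bool \<Rightarrow> fg" where
  "gval f l = (if snd l then f (fst l) else - f (fst l))"

lemma gval_inv_letter [simp]: "gval f (inv_letter l) = - gval f l"
  by (simp add: gval_def inv_letter_def)

lift_definition fghom :: "(nat \<Rightarrow> fg) \<Rightarrow> fg \<Rightarrow> fg" is "\<lambda>f w. foldr (\<lambda>l. (+) (gval f l)) w 0" .

lemma foldr_gval_push: "foldr (\<lambda>l. (+) (gval f l)) (push l w) 0 = gval f l + foldr (\<lambda>l. (+) (gval f l)) w 0"
  by (cases w) (auto simp: push_def)

lemma foldr_gval_foldr_push:
  "foldr (\<lambda>l. (+) (gval f l)) (foldr push v w) 0 =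
    foldr (\<lambda>l. (+) (gval f l)) v 0 + foldr (\<lambda>l. (+) (gval f l)) w 0"
  by (induction v) (simp_all add: foldr_gval_push add.assoc)

lemma hom_plus [simp]: "fghom f (u + v) = fghom f u + fghom f v"
  by transfer (rule foldr_gval_foldr_push)

lemma hom_zero [simp]: "fghom f 0 = 0"
  by transfer simp

lemma hom_minus [simp]: "fghom f (- u) = - fghom f u"
  by (metis hom_plus hom_zero add.right_inverse minus_unique)

lemma hom_diff [simp]: "fghom f (u - v) = fghom f u - fghom f v"
  by (metis hom_plus hom_minus add_uminus_conv_diff)

lemma hom_gen: "fghom f (gen l) = gval f l"
  by transfer simp

abbreviation g :: "nat \<Rightarrow> fg" where "g i \<equiv> gen (i, True)"

lemma hom_g [simp]: "fghom f (g i) = f i"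
  by (simp add: hom_gen gval_def)

lemma gen_False: "gen (i, False) = - g i"
  by transfer (simp add: push_def)

lemma gval_g: "gval g l = gen l"
  by (cases l) (auto simp: gval_def gen_False)

lemma gen_plus: "Rep_fg (gen l + u) = push l (Rep_fg u)"
  by transfer simp

lemma fg_induct [case_names zero gen]:
  assumes "Q 0" "\<And>l u. Q u \<Longrightarrow> Q (gen l + u)"
  shows "Q u"
proof -
  have "Q (Abs_fg w)" if "reduced w" for w
    using that
  proof (induction w)
    case Nil
    then show ?case using assms(1) by (simp add: zero_fg_def)
  next
    case (Cons l w)
    then have w: "reduced w" by (simp add: reduced_Cons)
    have "Rep_fg (gen l + Abs_fg w) = l # w"
      using Cons.prems w by (auto simp: gen_plus Abs_fg_inverse push_def reduced_Cons)
    then have "Abs_fg (l # w) = gen l + Abs_fg w" by (metis Rep_fg_inverse)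
    with assms(2) Cons.IH w show ?case by simp
  qed
  then show ?thesis using Rep_fg[of u] by (metis Rep_fg_inverse mem_Collect_eq)
qed

lemma hom_g_id [simp]: "fghom g u = u"
  by (induction u rule: fg_induct) (simp_all add: hom_gen gval_g)

lemma hom_hom: "fghom f (fghom h u) = fghom (\<lambda>i. fghom f (h i)) u"
  by (induction u rule: fg_induct) (simp_all add: hom_gen gval_def)

section \<open>Artin automorphisms and first letters\<close>

definition artin :: "nat \<Rightarrow> nat \<Rightarrow> fg" where
  "artin i = g(i := - g i + g (Suc i) + g i, Suc i := g i)"

definition artin_inv :: "nat \<Rightarrow> nat \<Rightarrow> fg" where
  "artin_inv i = g(i := g (Suc i), Suc i := g (Suc i) + g i - g (Suc i))"

lemma hom_artin_inv [simp]: "fghom (artin_inv i) (fghom (artin i) u) = u"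
proof -
  have "(\<lambda>j. fghom (artin_inv i) (artin i j)) = g"
    by (auto simp: fun_eq_iff artin_def artin_inv_def group_add_normal simp del: add_uminus_conv_diff)
  then show ?thesis by (simp add: hom_hom)
qed

text \<open>The reduced image of a reduced word under the inverse of an Artin automorphism, as far
  as its first letters are determined by the first letter of the word.\<close>

definition artin_head :: "nat \<Rightarrow> (nat \<times> bool) list \<Rightarrow> (nat \<times> bool) list \<Rightarrow> bool" where
  "artin_head i w p \<longleftrightarrow> (case w of [] \<Rightarrow> p = []
    | (k, b) # _ \<Rightarrow>
      if k = Suc i then (\<exists>q. p = (Suc i, True) # (i, b) # q)
      else if k = i then
        (if b then (\<exists>q. p = (Suc i, True) # q \<and> (q = [] \<or> fst (hd q) \<noteq> i))
         else p \<noteq> [] \<and> (hd p = (Suc i, False) \<or> fst (hd p) = i))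
      else (\<exists>q. p = (k, b) # q))"

text \<open>The word is built by prepending letters. The description of the head of the image is
  just strong enough to control the cancellations caused by the image of the next letter.\<close>

lemma artin_head: "artin_head i (Rep_fg u) (Rep_fg (fghom (artin_inv i) u))"
proof -
  define psi where "psi = (\<lambda>w. Rep_fg (foldr (\<lambda>l. (+) (gval (artin_inv i) l)) w 0))"
  have psi_Nil: "psi [] = []" by (simp add: psi_def zero_fg.rep_eq)
  have red: "reduced (psi w)" for w
    using Rep_fg by (auto simp: psi_def)
  have step: "psi ((k, b) # w) =
     (if k = Suc i then push (Suc i, True) (push (i, b) (push (Suc i, False) (psi w)))
      else if k = i then push (Suc i, b) (psi w) else push (k, b) (psi w))" for k b w
  proof -
    have "gval (artin_inv i) (k, b) = (if k = Suc i then gen (Suc i, True) + (gen (i, b) + gen (Suc i, False))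
      else if k = i then gen (Suc i, b) else gen (k, b))"
      by (cases b) (auto simp: gval_def artin_inv_def gen_False group_add_normal simp del: add_uminus_conv_diff)
    then show ?thesis by (simp add: psi_def gen_plus add.assoc)
  qed
  have "artin_head i w (psi w)" if "reduced w" for w
    using that
  proof (induction w)
    case Nil
    show ?case by (simp add: artin_head_def psi_Nil)
  next
    case (Cons l w)
    obtain k b where l: "l = (k, b)" by (cases l)
    from Cons have IH: "artin_head i w (psi w)" and h: "w = [] \<or> hd w \<noteq> inv_letter l"
      by (auto simp: reduced_Cons)
    show ?case
    proof (cases w)
      case Nil
      then show ?thesis by (auto simp: l artin_head_def step psi_Nil push_def)
    next
      case (Cons m v)
      obtain p where p: "psi w = p" by blast
      obtain k' b' where m: "m = (k', b')" by (cases m)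
      show ?thesis
        using IH h red[of w] unfolding l step p unfolding Cons m
        by (cases "k = Suc i"; cases "k = i"; cases "k' = Suc i"; cases "k' = i"; cases b; cases b'; cases "hd p")
          (auto simp: artin_head_def push_def reduced_Cons)
    qed
  qed
  moreover have "Rep_fg (fghom (artin_inv i) u) = psi (Rep_fg u)"
    by (simp add: psi_def fghom.rep_eq)
  ultimately show ?thesis using Rep_fg[of u] by simp
qed

definition neg_head :: "nat \<Rightarrow> fg \<Rightarrow> bool" where
  "neg_head k u \<longleftrightarrow> (\<exists>w. Rep_fg u = (k, False) # w)"

text \<open>Inspection of the possible heads. Read backwards, it gives stability under
  \<open>artin i\<close> even for \<open>k = i\<close>, whereas \<open>artin_inv i\<close> needs
  \<open>k < i\<close>; this matches the letters allowed in \<open>spos k\<close>.\<close>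

lemma neg_head_artin_inv: "k \<le> i \<Longrightarrow> neg_head k (fghom (artin_inv i) u) \<Longrightarrow> neg_head k u"
  using artin_head[of i u]
  by (auto simp: neg_head_def artin_head_def split: list.splits if_splits)

lemma artin_inv_neg_head: "k < i \<Longrightarrow> neg_head k u \<Longrightarrow> neg_head k (fghom (artin_inv i) u)"
  using artin_head[of i u]
  by (auto simp: neg_head_def artin_head_def split: list.splits if_splits)

lemma artin_neg_head: "k \<le> i \<Longrightarrow> neg_head k u \<Longrightarrow> neg_head k (fghom (artin i) u)"
  by (rule neg_head_artin_inv[of k i]) simp_all

lemma neg_head_artin: "neg_head k (artin k k)"
proof -
  have "artin k k = gen (k, False) + (gen (Suc k, True) + (gen (k, True) + 0))"
    by (simp add: artin_def gen_False add.assoc)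
  then show ?thesis
    unfolding neg_head_def by (simp only: gen_plus zero_fg.rep_eq) (simp add: push_def)
qed

section \<open>An action of the group of parenthesized braids\<close>

text \<open>A label \<open>t\<close> has a root \<open>t 0\<close> in the free group and splits uniquely into two labels whose roots
  multiply to \<open>t 0\<close>. Braid generators act on sequences of labels by conjugation, as in the
  Artin representation; the generator \<open>a i\<close> splits the \<open>i\<close>-th label.\<close>

definition lpart :: "(nat \<Rightarrow> fg) \<Rightarrow> nat \<Rightarrow> fg" where
  "lpart t n = t (2 * n + 1)"

definition rpart :: "(nat \<Rightarrow> fg) \<Rightarrow> nat \<Rightarrow> fg" where
  "rpart t n = (if n = 0 then t 0 - t 1 else t (2 * n))"

definition join :: "(nat \<Rightarrow> fg) \<Rightarrow> (nat \<Rightarrow> fg) \<Rightarrow> nat \<Rightarrow> fg" where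
  "join l r n = (if n = 0 then r 0 + l 0 else if odd n then l (n div 2) else r (n div 2))"

definition lconj :: "fg \<Rightarrow> (nat \<Rightarrow> fg) \<Rightarrow> nat \<Rightarrow> fg" where
  "lconj c t n = - c + t n + c"

lemma lpart_join [simp]: "lpart (join l r) = l"
  by (simp add: fun_eq_iff lpart_def join_def)

lemma rpart_join [simp]: "rpart (join l r) = r"
  by (simp add: fun_eq_iff rpart_def join_def)

lemma join_parts [simp]: "join (lpart t) (rpart t) = t"
  by (auto simp: fun_eq_iff lpart_def rpart_def join_def elim!: oddE)

lemma lconj_lconj: "lconj c (lconj d t) = lconj (d + c) t"
  by (simp add: fun_eq_iff lconj_def group_add_normal del: add_uminus_conv_diff)

lemma lconj_zero [simp]: "lconj 0 t = t"
  by (simp add: fun_eq_iff lconj_def)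

lemma lpart_lconj [simp]: "lpart (lconj c t) = lconj c (lpart t)"
  by (simp add: fun_eq_iff lpart_def lconj_def)

lemma rpart_lconj [simp]: "rpart (lconj c t) = lconj c (rpart t)"
  by (simp add: fun_eq_iff rpart_def lconj_def group_add_normal del: add_uminus_conv_diff)

lemma root_parts: "rpart t 0 + lpart t 0 = t 0"
  by (simp add: rpart_def lpart_def)

definition lab_s :: "nat \<Rightarrow> (nat \<Rightarrow> nat \<Rightarrow> fg) \<Rightarrow> nat \<Rightarrow> nat \<Rightarrow> fg" where
  "lab_s i x = x(i := lconj (x i 0) (x (Suc i)), Suc i := x i)"

definition lab_s_inv :: "nat \<Rightarrow> (nat \<Rightarrow> nat \<Rightarrow> fg) \<Rightarrow> nat \<Rightarrow> nat \<Rightarrow> fg" where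
  "lab_s_inv i x = x(i := x (Suc i), Suc i := lconj (- x (Suc i) 0) (x i))"

definition lab_a :: "nat \<Rightarrow> (nat \<Rightarrow> nat \<Rightarrow> fg) \<Rightarrow> nat \<Rightarrow> nat \<Rightarrow> fg" where
  "lab_a i x j = (if j < i then x j else if j = i then lpart (x i)
     else if j = Suc i then rpart (x i) else x (j - 1))"

definition lab_a_inv :: "nat \<Rightarrow> (nat \<Rightarrow> nat \<Rightarrow> fg) \<Rightarrow> nat \<Rightarrow> nat \<Rightarrow> fg" where
  "lab_a_inv i x j = (if j < i then x j else if j = i then join (x i) (x (Suc i)) else x (Suc j))"

interpretation lab: pb_action lab_s lab_s_inv lab_a lab_a_inv
proof (unfold_locales, goal_cases)
  case (1 i x)
  show ?case by (auto simp: fun_eq_iff lab_s_def lab_s_inv_def lconj_lconj)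
next
  case (2 i x)
  show ?case by (auto simp: fun_eq_iff lab_s_def lab_s_inv_def lconj_lconj)
next
  case (3 i x)
  show ?case by (rule ext) (auto simp: lab_a_def lab_a_inv_def)
next
  case (4 i x)
  show ?case by (rule ext) (auto simp: lab_a_def lab_a_inv_def)
next
  case (5 i j x)
  then show ?case by (auto simp: fun_eq_iff lab_s_def)
next
  case (6 i j x)
  then show ?case by (intro ext) (auto simp: lab_s_def lab_a_def)
next
  case (7 i j x)
  then show ?case by (intro ext) (auto simp: lab_a_def)
next
  case (8 i j x)
  then show ?case by (rule_tac ext, rename_tac k, case_tac k) (auto simp: lab_a_def lab_s_def)
next
  case (9 i x)
  show ?case
    by (auto simp: fun_eq_iff lab_s_def lconj_lconj lconj_def group_add_normal simp del: add_uminus_conv_diff)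
next
  case (10 i x)
  show ?case by (rule ext) (auto simp: lab_a_def lab_s_def)
next
  \<comment> \<open>A label that passes both halves is conjugated by the right root and then by the
    left one. By \<open>root_parts\<close> this is conjugation by the unsplit root, which dictates
    the order of the factors there.\<close>
  case (11 i x)
  show ?case by (rule ext) (auto simp: lab_a_def lab_s_def lconj_lconj root_parts)
qed

lemma lab_act_braids: "u \<in> braids (Suc k) \<Longrightarrow> lab.act u x k = x k"
proof (induction arbitrary: x rule: braids.induct)
  case (minus_s u j)
  have "lab.act (u - s j) x k = lab.act u (lab_s_inv j x) k"
    using lab.act_plus[of u "- s j" x] by simp
  also have "\<dots> = x k"
    using minus_s by (simp only: minus_s.IH) (simp add: lab_s_inv_def)
  finally show ?case .
next
  case (plus_s u j)
  then show ?case by (simp only: lab.act_plus lab.act_s) (simp add: lab_s_def)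
qed simp

lemma hom_lab_s: "fghom (\<lambda>j. lab_s i x j 0) w = fghom (\<lambda>j. x j 0) (fghom (artin i) w)"
proof -
  have "(\<lambda>j. lab_s i x j 0) = (\<lambda>j. fghom (\<lambda>j. x j 0) (artin i j))"
    by (auto simp: fun_eq_iff lab_s_def artin_def lconj_def)
  then show ?thesis by (simp add: hom_hom)
qed

lemma hom_lab_s_inv: "fghom (\<lambda>j. lab_s_inv i x j 0) w = fghom (\<lambda>j. x j 0) (fghom (artin_inv i) w)"
proof -
  have "(\<lambda>j. lab_s_inv i x j 0) = (\<lambda>j. fghom (\<lambda>j. x j 0) (artin_inv i j))"
    by (auto simp: fun_eq_iff lab_s_inv_def artin_inv_def lconj_def)
  then show ?thesis by (simp add: hom_hom)
qed

text \<open>The word for the root at position \<open>k\<close> starts out as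
  \<open>artin k k\<close>, which has a negative head; each further letter on the right applies an
  automorphism that keeps this head.\<close>

lemma lab_act_spos:
  "u \<in> spos k \<Longrightarrow> \<exists>w. neg_head k w \<and> (\<forall>x. lab.act u x k 0 = fghom (\<lambda>j. x j 0) w)"
proof (induction rule: spos.induct)
  case (start u)
  then have "lab.act (u + s k) x k 0 = fghom (\<lambda>j. x j 0) (artin k k)" for x
    by (simp add: lab_act_braids) (simp add: lab_s_def artin_def lconj_def)
  then show ?case using neg_head_artin by blast
next
  case (plus_s u j)
  then obtain w where w: "neg_head k w" "\<And>x. lab.act u x k 0 = fghom (\<lambda>j. x j 0) w" by blast
  with plus_s(2) show ?case
    by (intro exI[of _ "fghom (artin j) w"]) (simp add: hom_lab_s artin_neg_head)
next
  case (minus_s u j)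
  then obtain w where w: "neg_head k w" "\<And>x. lab.act u x k 0 = fghom (\<lambda>j. x j 0) w" by blast
  moreover have "lab.act (u - s j) x = lab.act u (lab_s_inv j x)" for x
    using lab.act_plus[of u "- s j" x] by simp
  ultimately show ?case
    using minus_s(2) by (intro exI[of _ "fghom (artin_inv j) w"]) (simp add: hom_lab_s_inv artin_inv_neg_head)
qed

theorem zero_notin_sigma_pos: "0 \<notin> sigma_pos"
proof
  assume "0 \<in> sigma_pos"
  then obtain k where "0 \<in> spos k" by (auto simp: sigma_pos_def)
  then obtain w where w: "neg_head k w" "\<And>x. x k 0 = fghom (\<lambda>j. x j 0) w"
    using lab_act_spos by fastforce
  \<comment> \<open>At labels whose roots are the free generators, \<open>w\<close> evaluates to
    itself.\<close>
  have "w = g k" using w(2)[of "\<lambda>j n. g j"] by simp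
  with w(1) show False by (simp add: neg_head_def gen.rep_eq)
qed

section \<open>Thompson's group and its action on the rationals\<close>

inductive_set amon :: "pb set" where
  zero [simp, intro]: "0 \<in> amon"
| plus_a: "u \<in> amon \<Longrightarrow> u + a j \<in> amon"

lemma amon_a [simp, intro]: "a j \<in> amon"
  using amon.plus_a[OF amon.zero] by simp

lemma amon_plus [intro]: "v \<in> amon \<Longrightarrow> u \<in> amon \<Longrightarrow> u + v \<in> amon"
  by (induction rule: amon.induct) (auto intro: amon.intros simp flip: add.assoc)

primrec apow :: "nat \<Rightarrow> nat \<Rightarrow> pb" where
  "apow k 0 = 0"
| "apow k (Suc n) = a k + apow k n"

lemma apow_a: "apow k n + a k = apow k (Suc n)"
  by (induction n) (simp_all add: add.assoc)

lemma apow_a_less: "k < j \<Longrightarrow> apow k n + a j = a (j + n) + apow k n"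
proof (induction n)
  case (Suc n)
  then have "apow k (Suc n) + a j = (a k + a (j + n)) + apow k n"
    by (simp add: add.assoc)
  also have "a k + a (j + n) = a (Suc (j + n)) + a k"
    using Suc.prems by (intro a_a) simp
  finally show ?case by (simp add: add.assoc)
qed simp

text \<open>The normal form of Thompson's monoid: \<open>n\<close> copies of \<open>a k\<close>
  stand on the right, the generators of larger index before them.\<close>

primrec nform :: "nat \<Rightarrow> nat list \<Rightarrow> pb" where
  "nform k [] = 0"
| "nform k (n # ns) = nform (Suc k) ns + apow k n"

lemma nform_replicate [simp]: "nform k (replicate m 0) = 0"
  by (induction m arbitrary: k) auto

lemma nform_append_zeros: "nform k (ns @ replicate m 0) = nform k ns"
  by (induction ns arbitrary: k) auto

lemma nform_single: "nform k (replicate m 0 @ [1]) = a (k + m)"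
  by (induction m arbitrary: k) auto

text \<open>A letter of index above \<open>k\<close> moves to the left past the \<open>n\<close>
  copies of \<open>a k\<close>, each of which raises its index by one.\<close>

lemma nform_a: "k \<le> j \<Longrightarrow> \<exists>ns'. nform k ns + a j = nform k ns'"
proof (induction ns arbitrary: k j)
  case Nil
  then show ?case using nform_single[of k "j - k"] by (metis add_0 le_add_diff_inverse nform.simps(1))
next
  case (Cons n ns)
  show ?case
  proof (cases "k = j")
    case True
    then have "nform k (n # ns) + a j = nform k (Suc n # ns)"
      using apow_a[of k n] by (simp add: add.assoc)
    then show ?thesis by blast
  next
    case False
    then have "nform k (n # ns) + a j = (nform (Suc k) ns + a (j + n)) + apow k n"
      using Cons.prems apow_a_less[of k j n] by (simp add: add.assoc)
    moreover obtain ns' where "nform (Suc k) ns + a (j + n) = nform (Suc k) ns'"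
      using Cons.IH[of "Suc k" "j + n"] Cons.prems False by auto
    ultimately have "nform k (n # ns) + a j = nform k (n # ns')" by simp
    then show ?thesis by blast
  qed
qed

lemma amon_nform: "u \<in> amon \<Longrightarrow> \<exists>ns. u = nform 0 ns"
proof (induction rule: amon.induct)
  case zero
  show ?case by (metis nform.simps(1))
next
  case (plus_a u j)
  then show ?case using nform_a[of 0 j] by blast
qed

section \<open>The action on the rationals\<close>

definition rat_a :: "nat \<Rightarrow> rat \<Rightarrow> rat" where
  "rat_a i t = (if t \<le> of_nat i then t else if t \<le> of_nat i + 1 then 2 * t - of_nat i else t + 1)"

definition rat_a_inv :: "nat \<Rightarrow> rat \<Rightarrow> rat" where
  "rat_a_inv i t = (if t \<le> of_nat i then t else if t \<le> of_nat i + 2 then (t + of_nat i) / 2 else t - 1)"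

text \<open>Unit intervals play the role of strands: \<open>rat_s i\<close> exchanges two neighbours
  without regard to over and under, and \<open>rat_a i\<close> stretches the \<open>i\<close>-th
  interval over two.\<close>

definition rat_s :: "nat \<Rightarrow> rat \<Rightarrow> rat" where
  "rat_s i t = (if of_nat i \<le> t \<and> t < of_nat i + 1 then t + 1
     else if of_nat i + 1 \<le> t \<and> t < of_nat i + 2 then t - 1 else t)"

interpretation rat: pb_action rat_s rat_s rat_a rat_a_inv
proof
  fix i j :: nat and x :: rat
  show "rat_s i (rat_s i x) = x"
    "rat_s i (rat_s (Suc i) (rat_s i x)) = rat_s (Suc i) (rat_s i (rat_s (Suc i) x))"
    by (auto simp: rat_s_def)
  show "rat_s (Suc i) (rat_s i (rat_a (Suc i) x)) = rat_a i (rat_s i x)"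
    "rat_s i (rat_s (Suc i) (rat_a i x)) = rat_a (Suc i) (rat_s i x)"
    by (auto simp: rat_s_def rat_a_def)
  show "rat_a i (rat_a_inv i x) = x" "rat_a_inv i (rat_a i x) = x"
    unfolding rat_a_def rat_a_inv_def by (auto simp: divide_simps)
  show "rat_s i (rat_s j x) = rat_s j (rat_s i x)" "rat_s i (rat_a j x) = rat_a j (rat_s i x)"
    if "i + 2 \<le> j"
  proof -
    from that have "of_nat i + 2 \<le> (of_nat j :: rat)"
      by (metis of_nat_add of_nat_le_iff of_nat_numeral)
    then show "rat_s i (rat_s j x) = rat_s j (rat_s i x)" "rat_s i (rat_a j x) = rat_a j (rat_s i x)"
      by (auto simp: rat_s_def rat_a_def)
  qed
  show "rat_a i (rat_a j x) = rat_a (Suc j) (rat_a i x)" "rat_a i (rat_s j x) = rat_s (Suc j) (rat_a i x)"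
    if "i < j"
  proof -
    from that have "of_nat (Suc i) \<le> (of_nat j :: rat)" by (simp only: of_nat_le_iff Suc_leI)
    then show "rat_a i (rat_a j x) = rat_a (Suc j) (rat_a i x)"
      "rat_a i (rat_s j x) = rat_s (Suc j) (rat_a i x)"
      by (auto simp: rat_s_def rat_a_def)
  qed
qed

lemma rat_act_amon_mono: "u \<in> amon \<Longrightarrow> strict_mono (rat.act u)"
proof (induction rule: amon.induct)
  case (plus_a u j)
  have "strict_mono (rat_a j)"
    by (auto simp: strict_mono_def rat_a_def)
  with plus_a show ?case by (simp add: strict_mono_def)
qed (simp add: strict_mono_def)

lemma rat_act_less_iff: "u \<in> amon \<Longrightarrow> rat.act u x < rat.act u y \<longleftrightarrow> x < y"
  by (simp add: rat_act_amon_mono strict_mono_less)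

lemma rat_act_minus_less_iff: "u \<in> amon \<Longrightarrow> rat.act (- u) x < rat.act (- u) y \<longleftrightarrow> x < y"
  by (metis rat.act_minus_cancel(1) rat_act_less_iff)

lemma rat_act_apow_le: "t \<le> of_nat k \<Longrightarrow> rat.act (apow k n) t = t"
  by (induction n) (simp_all add: rat_a_def)

lemma rat_act_apow: "0 \<le> d \<Longrightarrow> 2 ^ n * d \<le> 1 \<Longrightarrow> rat.act (apow k n) (of_nat k + d) = of_nat k + 2 ^ n * d"
proof (induction n)
  case (Suc n)
  define p where "p = 2 ^ n * d"
  have p: "0 \<le> p" "2 * p \<le> 1" using Suc.prems by (simp_all add: p_def)
  then have "rat.act (apow k n) (of_nat k + d) = of_nat k + p"
    using Suc by (simp add: p_def)
  then have "rat.act (apow k (Suc n)) (of_nat k + d) = of_nat k + 2 * p"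
    using p by (auto simp: rat_a_def)
  then show ?case by (simp add: p_def)
qed simp

lemma rat_act_nform_le: "t \<le> of_nat k \<Longrightarrow> rat.act (nform k ns) t = t"
  by (induction ns arbitrary: k) (simp_all add: rat_act_apow_le)

lemma rat_act_nform:
  assumes "0 \<le> d" "2 ^ n * d \<le> 1"
  shows "rat.act (nform k (n # ns)) (of_nat k + d) = of_nat k + 2 ^ n * d"
  using assms by (simp add: rat_act_apow rat_act_nform_le)

text \<open>The exponent of \<open>a k\<close> in a normal form is read off the slope to the right of \<open>k\<close>.\<close>

lemma nform_faithful:
  assumes "length ns = length ms" "\<And>t. rat.act (nform k ns) t = rat.act (nform k ms) t"
  shows "nform k ns = nform k ms"
  using assms
proof (induction ns ms arbitrary: k rule: list_induct2)
  case (Cons n ns m ms)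
  \<comment> \<open>Small enough that the images stay in the first unit interval after
    \<open>k\<close> for both exponents.\<close>
  define d :: rat where "d = 1 / 2 ^ max n m"
  have d: "0 \<le> d" "2 ^ n * d \<le> 1" "2 ^ m * d \<le> 1" "d \<noteq> 0"
    by (auto simp: d_def field_simps intro: power_increasing)
  have "of_nat k + 2 ^ n * d = of_nat k + 2 ^ m * d"
    using Cons.prems[of "of_nat k + d"] d by (simp only: rat_act_nform)
  then have nm: "n = m" using d(4) by simp
  have "rat.act (nform (Suc k) ns) t = rat.act (nform (Suc k) ms) t" for t
    using Cons.prems[of "rat.act (- apow k m) t"] by (simp add: nm)
  then show ?case using Cons.IH by (simp add: nm)
qed simp

theorem amon_faithful:
  assumes "u \<in> amon" "v \<in> amon" "\<And>t. rat.act u t = rat.act v t"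
  shows "u = v"
proof -
  obtain ns ms where nf: "u = nform 0 ns" "v = nform 0 ms"
    using assms(1,2)[THEN amon_nform] by blast
  \<comment> \<open>Padding with zeros makes the lists equally long without changing their
    values.\<close>
  let ?ns = "ns @ replicate (length ms) 0" and ?ms = "ms @ replicate (length ns) 0"
  have "nform 0 ?ns = nform 0 ?ms"
    using assms(3) by (intro nform_faithful) (simp_all add: nform_append_zeros nf)
  then show ?thesis by (simp add: nform_append_zeros nf)
qed

section \<open>Fractions of products of generators \<open>a i\<close>\<close>

lemma a_diff_a: "\<exists>e\<in>insert 0 (range a). \<exists>f\<in>amon. a k - a j = - e + f"
proof -
  consider "k = j" | "j < k" | "k < j" by linarith
  then show ?thesis
  proof cases
    case 1
    then show ?thesis by (auto intro: bexI[of _ 0])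
  next
    case 2
    then have "a k - a j = - a j + a (Suc k)"
      by (metis a_a add_diff_cancel add_diff_eq minus_add_cancel)
    then show ?thesis by blast
  next
    case 3
    then have "a k - a j = - a (Suc j) + a k"
      by (metis a_a add_diff_cancel add_diff_eq minus_add_cancel)
    then show ?thesis by blast
  qed
qed

text \<open>A single letter remains at most one letter while it passes through \<open>u\<close>.
  Keeping track of this lets \<open>amon_diff\<close> proceed by induction on the letters of the
  subtracted factor.\<close>

lemma amon_diff_a:
  "u \<in> amon \<Longrightarrow> e \<in> insert 0 (range a) \<Longrightarrow> \<exists>e'\<in>insert 0 (range a). \<exists>f\<in>amon. u - e = - e' + f"
proof (induction arbitrary: e rule: amon.induct)
  case zero
  then show ?case by (intro bexI[of _ e] bexI[of _ 0]) auto
next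
  case (plus_a u k)
  show ?case
  proof (cases "e = 0")
    case True
    with plus_a show ?thesis by (intro bexI[of _ 0] bexI[of _ "u + a k"]) (auto intro: amon.intros)
  next
    case False
    with plus_a.prems obtain j where "e = a j" by auto
    with a_diff_a obtain e1 f1 where 1: "e1 \<in> insert 0 (range a)" "f1 \<in> amon" "a k - e = - e1 + f1"
      by metis
    with plus_a.IH obtain e2 f2 where 2: "e2 \<in> insert 0 (range a)" "f2 \<in> amon" "u - e1 = - e2 + f2"
      by metis
    have "u + a k - e = (u - e1) + f1"
      using 1(3) by (simp add: group_add_normal del: add_uminus_conv_diff)
    then have "u + a k - e = - e2 + (f2 + f1)" by (simp add: 2(3) add.assoc)
    with 1 2 show ?thesis by blast
  qed
qed

lemma amon_diff: "v \<in> amon \<Longrightarrow> u \<in> amon \<Longrightarrow> \<exists>e\<in>amon. \<exists>f\<in>amon. u - v = - e + f"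
proof (induction arbitrary: u rule: amon.induct)
  case zero
  then show ?case by (intro bexI[of _ 0] bexI[of _ u]) auto
next
  case (plus_a v j)
  obtain e1 f1 where 1: "e1 \<in> amon" "f1 \<in> amon" "u - a j = - e1 + f1"
    using amon_diff_a[OF plus_a.prems, of "a j"] by blast
  with plus_a.IH obtain e2 f2 where 2: "e2 \<in> amon" "f2 \<in> amon" "f1 - v = - e2 + f2" by metis
  have "u - (v + a j) = - e1 + (f1 - v)"
    by (simp only: diff_add_eq_diff_diff_swap 1(3) add_diff_eq)
  also have "\<dots> = - (e2 + e1) + f2"
    by (simp only: 2(3) minus_add add.assoc)
  finally show ?case using 1 2 by blast
qed

section \<open>Cabling\<close>

definition swap :: "nat \<Rightarrow> nat \<Rightarrow> nat" where
  "swap i k = (if k = i then Suc i else if k = Suc i then i else k)"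

lemma swap_swap [simp]: "swap i (swap i k) = k"
  by (simp add: swap_def)

text \<open>The crossing \<open>s i\<close> with strand \<open>k\<close> doubled: two crossings if
  that strand takes part, and otherwise one, renumbered when the doubled strand comes before
  it.\<close>

definition cable :: "nat \<Rightarrow> nat \<Rightarrow> pb" where
  "cable k i = (if k < i then s (Suc i) else if k = i then s (Suc i) + s i
     else if k = Suc i then s i + s (Suc i) else s i)"

lemma a_plus_s: "a k + s i = cable k i + a (swap i k)"
proof -
  consider "k < i" | "k = i" | "k = Suc i" | "i + 2 \<le> k" by linarith
  then show ?thesis
  proof cases
    case 1
    then show ?thesis using a_s[of k i] by (simp add: cable_def swap_def)
  next
    case 2
    then show ?thesis using s_s_a[of i] by (simp add: cable_def swap_def add.assoc)
  next
    case 3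
    then show ?thesis using s_s_a'[of i] by (simp add: cable_def swap_def add.assoc)
  next
    case 4
    then show ?thesis using s_a[of i k] by (simp add: cable_def swap_def)
  qed
qed

lemma a_diff_s: "a k - s i = - cable (swap i k) i + a (swap i k)"
proof -
  have "cable (swap i k) i + a k = a (swap i k) + s i"
    using a_plus_s[of "swap i k" i] by simp
  then show ?thesis by (metis add_diff_cancel add_diff_eq minus_add_cancel)
qed

lemma cable_braids: "l \<le> i \<Longrightarrow> cable k i \<in> braids l"
  by (auto simp: cable_def)

lemma cable_spos: "i \<le> k \<Longrightarrow> cable k i \<in> spos i"
  by (auto simp: cable_def)

text \<open>The two ends of a cabled strand determine each other, so a cabling can be prescribed
  at either end.\<close>

definition cables :: "nat \<Rightarrow> pb set \<Rightarrow> pb \<Rightarrow> bool" where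
  "cables l U u \<longleftrightarrow> (\<forall>k\<ge>l. \<exists>k'\<ge>l. \<exists>u'\<in>U. a k + u = u' + a k') \<and>
     (\<forall>k'\<ge>l. \<exists>k\<ge>l. \<exists>u'\<in>U. a k + u = u' + a k')"

text \<open>Here \<open>w k\<close> is the factor \<open>v\<close> after cabling and
  \<open>p\<close> the permutation of positions that it causes; as \<open>p\<close> is an
  involution, the position at the other end can be prescribed too.\<close>

lemma cablesI:
  assumes "cables l U u"
    and "\<And>k. a k + v = w k + a (p k)" "\<And>k. l \<le> k \<Longrightarrow> l \<le> p k" "\<And>k. p (p k) = k"
    and "\<And>k u'. l \<le> k \<Longrightarrow> u' \<in> U \<Longrightarrow> u' + w k \<in> V"
  shows "cables l V (u + v)"
  unfolding cables_def
proof (intro conjI allI impI)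
  fix k assume "l \<le> k"
  then obtain k' u' where "l \<le> k'" "u' \<in> U" "a k + u = u' + a k'"
    using assms(1) by (auto simp: cables_def)
  then show "\<exists>k'\<ge>l. \<exists>u'\<in>V. a k + (u + v) = u' + a k'"
    using assms(2)[of k'] assms(3)[of k'] assms(5)[of k' u']
    by (intro exI[of _ "p k'"] conjI bexI[of _ "u' + w k'"]) (simp_all add: add.assoc flip: add.assoc[of _ u])
next
  fix k assume k: "l \<le> k"
  then obtain j u' where "l \<le> j" "u' \<in> U" "a j + u = u' + a (p k)"
    using assms(1) assms(3)[of k] by (auto simp: cables_def)
  then show "\<exists>j\<ge>l. \<exists>u'\<in>V. a j + (u + v) = u' + a k"
    using assms(2)[of "p k"] assms(3)[OF k] assms(4)[of k] assms(5)[of "p k" u']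
    by (intro exI[of _ j] conjI bexI[of _ "u' + w (p k)"]) (simp_all add: add.assoc flip: add.assoc[of _ u])
qed

lemma swap_le: "l \<le> i \<Longrightarrow> l \<le> k \<Longrightarrow> l \<le> swap i k"
  by (simp add: swap_def)

lemma cables_plus_s:
  assumes "cables l U u" "l \<le> i" "\<And>k u'. l \<le> k \<Longrightarrow> u' \<in> U \<Longrightarrow> u' + cable k i \<in> V"
  shows "cables l V (u + s i)"
  using assms by (intro cablesI[OF assms(1), of "s i" "\<lambda>k. cable k i" "swap i"]) (auto simp: a_plus_s swap_le)

lemma cables_diff_s:
  assumes "cables l U u" "l \<le> i" "\<And>k u'. l \<le> k \<Longrightarrow> u' \<in> U \<Longrightarrow> u' - cable k i \<in> V"
  shows "cables l V (u - s i)"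
  using assms cablesI[OF assms(1), of "- s i" "\<lambda>k. - cable (swap i k) i" "swap i" V]
  by (auto simp: a_diff_s swap_le)

lemma cables_zero: "0 \<in> U \<Longrightarrow> cables l U 0"
  unfolding cables_def by (metis add_0 add_0_right)

lemma braids_cables: "u \<in> braids l \<Longrightarrow> cables l (braids l) u"
proof (induction rule: braids.induct)
  case (plus_s u j)
  then show ?case by (intro cables_plus_s[OF plus_s.IH]) (auto intro: cable_braids)
next
  case (minus_s u j)
  then show ?case by (intro cables_diff_s[OF minus_s.IH]) (auto intro: cable_braids)
qed (simp add: cables_zero)

text \<open>Needed for the prefix in \<open>spos.start\<close>: the doubled strand may be number
  \<open>l\<close> itself, although all letters have larger index.\<close>

lemma braids_cables_Suc: "u \<in> braids (Suc l) \<Longrightarrow> cables l (braids (Suc l)) u"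
proof (induction rule: braids.induct)
  case (plus_s u j)
  then show ?case by (intro cables_plus_s[OF plus_s.IH]) (auto intro: cable_braids)
next
  case (minus_s u j)
  then show ?case by (intro cables_diff_s[OF minus_s.IH]) (auto intro: cable_braids)
qed (simp add: cables_zero)

lemma spos_cables: "u \<in> spos l \<Longrightarrow> cables l (spos l) u"
proof (induction rule: spos.induct)
  case (start u)
  then show ?case
    by (intro cables_plus_s[OF braids_cables_Suc]) (auto intro: cable_spos)
next
  case (plus_s u j)
  show ?case
  proof (rule cables_plus_s[OF plus_s.IH \<open>l \<le> j\<close>])
    fix k u' assume "l \<le> k" "u' \<in> spos l"
    then show "u' + cable k j \<in> spos l"
      using plus_s(2) cable_spos[of l k] cable_braids[of "Suc l" j k]
      by (cases "j = l") (auto intro: spos_plus)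
  qed
next
  case (minus_s u j)
  show ?case
  proof (rule cables_diff_s[OF minus_s.IH])
    fix k u' assume "l \<le> k" "u' \<in> spos l"
    then show "u' - cable k j \<in> spos l"
      using minus_s(2) spos_plus_braids[of "- cable k j" l u'] cable_braids[of "Suc l" j k]
      by auto
  qed (use minus_s(2) in simp)
qed

lemma a_plus_braids_less: "u \<in> braids l \<Longrightarrow> k < l \<Longrightarrow> \<exists>u'\<in>braids (Suc l). a k + u = u' + a k"
proof (induction rule: braids.induct)
  case zero
  show ?case by (auto intro: bexI[of _ 0])
next
  case (plus_s u j)
  then obtain u' where u': "u' \<in> braids (Suc l)" "a k + u = u' + a k" by blast
  have "a k + (u + s j) = u' + s (Suc j) + a k"
    using u'(2) a_s[of k j] plus_s by (simp add: add.assoc flip: add.assoc[of _ u])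
  with u' plus_s show ?case by (intro bexI[of _ "u' + s (Suc j)"]) auto
next
  case (minus_s u j)
  then obtain u' where u': "u' \<in> braids (Suc l)" "a k + u = u' + a k" by blast
  have "a k - s j = - s (Suc j) + a k"
    using a_s[of k j] minus_s by (metis add_diff_cancel add_diff_eq minus_add_cancel less_le_trans)
  then have "a k + (u - s j) = u' - s (Suc j) + a k"
    using u'(2) by (simp add: group_add_normal del: add_uminus_conv_diff flip: add.assoc[of _ u])
  with u' minus_s show ?case by (intro bexI[of _ "u' - s (Suc j)"]) auto
qed

lemma a_plus_spos_less: "u \<in> spos l \<Longrightarrow> k < l \<Longrightarrow> \<exists>u'\<in>spos (Suc l). a k + u = u' + a k"
proof (induction rule: spos.induct)
  case (start u)
  then obtain u' where u': "u' \<in> braids (Suc (Suc l))" "a k + u = u' + a k"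
    using a_plus_braids_less by (meson less_SucI)
  have "a k + (u + s l) = u' + s (Suc l) + a k"
    using u'(2) a_s[of k l] start by (simp add: add.assoc flip: add.assoc[of _ u])
  with u' show ?case using spos.start by blast
next
  case (plus_s u j)
  then obtain u' where u': "u' \<in> spos (Suc l)" "a k + u = u' + a k" by blast
  have "a k + (u + s j) = u' + s (Suc j) + a k"
    using u'(2) a_s[of k j] plus_s by (simp add: add.assoc flip: add.assoc[of _ u])
  with u' plus_s show ?case by (intro bexI[of _ "u' + s (Suc j)"]) (auto intro: spos.intros)
next
  case (minus_s u j)
  then obtain u' where u': "u' \<in> spos (Suc l)" "a k + u = u' + a k" by blast
  have "a k - s j = - s (Suc j) + a k"
    using a_s[of k j] minus_s by (metis add_diff_cancel add_diff_eq minus_add_cancel less_trans)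
  then have "a k + (u - s j) = u' - s (Suc j) + a k"
    using u'(2) by (simp add: group_add_normal del: add_uminus_conv_diff flip: add.assoc[of _ u])
  with u' minus_s show ?case by (intro bexI[of _ "u' - s (Suc j)"]) (auto intro: spos.intros)
qed

text \<open>Doubling a strand below the main index only raises the indices of all letters; the
  remaining strands are covered by \<open>spos_cables\<close>.\<close>

lemma sigma_pos_cables: "u \<in> sigma_pos \<Longrightarrow> cables 0 sigma_pos u"
proof -
  assume "u \<in> sigma_pos"
  then obtain l where l: "u \<in> spos l" by (auto simp: sigma_pos_def)
  have "(\<exists>k'. \<exists>u'\<in>sigma_pos. a k + u = u' + a k') \<and> (\<exists>k'. \<exists>u'\<in>sigma_pos. a k' + u = u' + a k)" for k
  proof (cases "k < l")
    case True
    then show ?thesis using a_plus_spos_less[OF l] by blast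
  next
    case False
    then show ?thesis using spos_cables[OF l] unfolding cables_def by (meson not_less sigma_posI)
  qed
  then show ?thesis by (auto simp: cables_def)
qed

section \<open>Moving products of generators \<open>a i\<close> across braids\<close>

lemma cables_amon_left:
  assumes "f \<in> amon" "\<And>u. u \<in> U \<Longrightarrow> cables 0 U u" "u \<in> U"
  shows "\<exists>f'\<in>amon. \<exists>u'\<in>U. f + u = u' + f'"
  using assms(1,3)
proof (induction arbitrary: u rule: amon.induct)
  case zero
  then show ?case by (intro bexI[of _ 0] bexI[of _ u]) auto
next
  case (plus_a f j)
  then obtain k u1 where 1: "u1 \<in> U" "a j + u = u1 + a k"
    using assms(2)[OF plus_a.prems] unfolding cables_def by (metis le0)
  with plus_a.IH obtain f' u2 where "f' \<in> amon" "u2 \<in> U" "f + u1 = u2 + f'" by blast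
  moreover from this 1 have "f + a j + u = u2 + (f' + a k)" by (metis add.assoc)
  ultimately show ?case by (blast intro: amon.intros)
qed

text \<open>The factor on the right is prescribed now, which calls for the second half of
  \<open>cables\<close>.\<close>

lemma cables_amon_right:
  assumes "f \<in> amon" "\<And>u. u \<in> U \<Longrightarrow> cables 0 U u" "u \<in> U"
  shows "\<exists>f'\<in>amon. \<exists>u'\<in>U. f' + u = u' + f"
  using assms(1,3)
proof (induction arbitrary: u rule: amon.induct)
  case zero
  then show ?case by (intro bexI[of _ 0] bexI[of _ u]) auto
next
  case (plus_a f j)
  then obtain k u1 where 1: "u1 \<in> U" "a k + u = u1 + a j"
    using assms(2)[OF plus_a.prems] unfolding cables_def by (metis le0)
  with plus_a.IH obtain f' u2 where "f' \<in> amon" "u2 \<in> U" "f' + u1 = u2 + f" by blast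
  moreover from this 1 have "f' + a k + u = u2 + (f + a j)" by (metis add.assoc)
  ultimately show ?case by (blast intro: amon.intros)
qed

theorem pb_decomposition: "\<exists>f\<in>amon. \<exists>b\<in>braids 0. \<exists>h\<in>amon. u = - f + b + h"
proof (induction u rule: pb_induct)
  case zero
  show ?case by (intro bexI[of _ 0]) auto
next
  case (s i u)
  then obtain f b h where u: "f \<in> amon" "b \<in> braids 0" "h \<in> amon" "u = - f + b + h" by blast
  \<comment> \<open>The inverse letter is cabled; negating the equation then rewrites
    \<open>s i - f\<close>.\<close>
  obtain f' b' where "f' \<in> amon" "b' \<in> braids 0" "f + - s i = b' + f'"
    using cables_amon_left[OF u(1) braids_cables, of "- s i"] by auto
  then have "s i + u = - f' + (- b' + b) + h" using u(4)
    by (metis add.assoc minus_add minus_minus)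
  then show ?case using u \<open>f' \<in> amon\<close> \<open>b' \<in> braids 0\<close> by blast
next
  case (ms i u)
  then obtain f b h where u: "f \<in> amon" "b \<in> braids 0" "h \<in> amon" "u = - f + b + h" by blast
  obtain f' b' where "f' \<in> amon" "b' \<in> braids 0" "f + s i = b' + f'"
    using cables_amon_left[OF u(1) braids_cables, of "s i"] by auto
  then have "- s i + u = - f' + (- b' + b) + h" using u(4)
    by (metis add.assoc minus_add)
  then show ?case using u \<open>f' \<in> amon\<close> \<open>b' \<in> braids 0\<close> by blast
next
  case (a i u)
  then obtain f b h where u: "f \<in> amon" "b \<in> braids 0" "h \<in> amon" "u = - f + b + h" by blast
  \<comment> \<open>The negative of this fraction is \<open>a i - f\<close>, the beginning of
    \<open>a i + u\<close>.\<close>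
  obtain e f' where e: "e \<in> amon" "f' \<in> amon" "f - a i = - e + f'"
    using amon_diff[of "a i" f] u(1) by auto
  obtain e' b' where e': "e' \<in> amon" "b' \<in> braids 0" "e + b = b' + e'"
    using cables_amon_left[OF e(1) braids_cables u(2)] by auto
  have "a i - f = - f' + e" using e(3) by (metis minus_add minus_diff_eq minus_minus)
  then have "a i + u = - f' + (e + b) + h" using u(4)
    by (simp add: group_add_normal del: add_uminus_conv_diff) (metis add.assoc)
  then have "a i + u = - f' + b' + (e' + h)" using e' by (simp add: add.assoc)
  then show ?case using u e e' by blast
next
  case (ma i u)
  then obtain f b h where u: "f \<in> amon" "b \<in> braids 0" "h \<in> amon" "u = - f + b + h" by blast
  then have "- a i + u = - (f + a i) + b + h"
    by (simp add: group_add_normal del: add_uminus_conv_diff)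
  then show ?case using u(2,3) amon.plus_a[OF u(1)] by blast
qed

section \<open>The positive cone\<close>

lemma strict_mono_surj_nat:
  fixes p :: "nat \<Rightarrow> nat"
  assumes "strict_mono p" "surj p"
  shows "p n = n"
proof (induction n rule: less_induct)
  case (less n)
  obtain m where m: "p m = n" using assms(2) by (metis surjD)
  then have "m \<le> n" using strict_mono_imp_increasing[OF assms(1), of m] by simp
  then have "m = n" using less.IH[of m] m by (cases "m < n") auto
  with m show ?case by simp
qed

lemma rat_s_unit_interval: "0 \<le> d \<Longrightarrow> d < 1 \<Longrightarrow> rat_s j (of_nat n + d) = of_nat (swap j n) + d"
proof -
  assume d: "0 \<le> d" "d < 1"
  consider "n < j" | "n = j" | "n = Suc j" | "Suc (Suc j) \<le> n" by linarith
  then show ?thesis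
  proof cases
    case 1
    then have "of_nat (Suc n) \<le> (of_nat j :: rat)" by (simp only: of_nat_le_iff Suc_leI)
    with 1 d show ?thesis by (auto simp: rat_s_def swap_def)
  next
    case 4
    then have "of_nat (Suc (Suc j)) \<le> (of_nat n :: rat)" by (simp only: of_nat_le_iff)
    with 4 d show ?thesis by (auto simp: rat_s_def swap_def)
  qed (use d in \<open>auto simp: rat_s_def swap_def\<close>)
qed

lemma surj_swap: "surj (swap j)"
  by (rule surjI[of _ "swap j"]) simp

lemma rat_act_braids:
  "u \<in> braids 0 \<Longrightarrow> (\<forall>t<0. rat.act u t = t) \<and>
    (\<exists>p. surj p \<and> (\<forall>n d. 0 \<le> d \<longrightarrow> d < 1 \<longrightarrow> rat.act u (of_nat n + d) = of_nat (p n) + d))"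
proof (induction rule: braids.induct)
  case zero
  show ?case by (auto intro: exI[of _ id])
next
  case (plus_s u j)
  then obtain p where "surj p" and p: "\<And>n d. 0 \<le> d \<Longrightarrow> d < 1 \<Longrightarrow> rat.act u (of_nat n + d) = of_nat (p n) + d"
    by blast
  have "surj (p \<circ> swap j)"
    by (rule comp_surj[OF surj_swap \<open>surj p\<close>])
  moreover have "rat_s j t = t" if "t < 0" for t
    using that by (auto simp: rat_s_def)
  ultimately show ?case
    using plus_s.IH by (auto intro!: exI[of _ "p \<circ> swap j"] simp: rat_s_unit_interval p)
next
  case (minus_s u j)
  then obtain p where "surj p" and p: "\<And>n d. 0 \<le> d \<Longrightarrow> d < 1 \<Longrightarrow> rat.act u (of_nat n + d) = of_nat (p n) + d"
    by blast
  have "surj (p \<circ> swap j)"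
    by (rule comp_surj[OF surj_swap \<open>surj p\<close>])
  moreover have "rat_s j t = t" if "t < 0" for t
    using that by (auto simp: rat_s_def)
  moreover have "rat.act (u - s j) t = rat.act u (rat_s j t)" for t
    using rat.act_plus[of u "- s j" t] by simp
  ultimately show ?case
    using minus_s.IH by (auto intro!: exI[of _ "p \<circ> swap j"] simp: rat_s_unit_interval p)
qed

text \<open>A braid permutes unit intervals, so it acts increasingly only if it acts trivially.\<close>

lemma braids_eq_amon_diff:
  assumes "u \<in> braids 0" "f \<in> amon" "h \<in> amon" "u = f - h"
  shows "u = 0"
proof -
  have mono: "rat.act u x < rat.act u y \<longleftrightarrow> x < y" for x y
    using assms(2-4) rat.act_plus[of f "- h"] by (simp add: rat_act_less_iff rat_act_minus_less_iff)
  from rat_act_braids[OF assms(1)] obtain p where "surj p" and neg: "\<And>t. t < 0 \<Longrightarrow> rat.act u t = t"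
    and p: "\<And>n d. 0 \<le> d \<Longrightarrow> d < 1 \<Longrightarrow> rat.act u (of_nat n + d) = of_nat (p n) + d"
    by blast
  have "strict_mono p"
    using mono p[of 0] by (simp add: strict_mono_def) (metis of_nat_less_iff)
  then have id: "p n = n" for n using \<open>surj p\<close> by (rule strict_mono_surj_nat)
  have "rat.act u t = t" for t
  proof (cases "t < 0")
    case False
    then have "t = of_nat (nat \<lfloor>t\<rfloor>) + frac t" by (simp add: frac_def)
    then show ?thesis using p[of "frac t" "nat \<lfloor>t\<rfloor>"] by (simp add: id frac_lt_1)
  qed (rule neg)
  then have "rat.act f t = rat.act h t" for t
    using rat.act_plus[of u h t] by (simp add: assms(4))
  then have "f = h" using assms by (intro amon_faithful)
  then show ?thesis by (simp add: assms(4))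
qed

section \<open>Ordering increasing permutations of the rationals\<close>

definition up :: "pb \<Rightarrow> bool" where
  "up u \<longleftrightarrow> (\<exists>n. (\<forall>m<n. rat.act u (from_nat m) = from_nat m) \<and> from_nat n < rat.act u (from_nat n))"

text \<open>At index \<open>min m n\<close> one factor moves the point to the right while the other
  does not move it to the left. As \<open>v\<close> acts first, its inequality is transported by the
  increasing map of \<open>u\<close>.\<close>

lemma up_plus:
  assumes "up u" "up v" "\<And>x y. rat.act u x < rat.act u y \<longleftrightarrow> x < y"
  shows "up (u + v)"
proof -
  from assms(1,2) obtain m n
    where m: "\<And>k. k < m \<Longrightarrow> rat.act u (from_nat k) = from_nat k" "from_nat m < rat.act u (from_nat m)"
      and n: "\<And>k. k < n \<Longrightarrow> rat.act v (from_nat k) = from_nat k" "from_nat n < rat.act v (from_nat n)"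
    unfolding up_def by blast
  have "from_nat (min m n) < rat.act (u + v) (from_nat (min m n))"
  proof -
    consider "m < n" | "n \<le> m" by linarith
    then show ?thesis
    proof cases
      case 1
      then show ?thesis using m n by (simp add: min_def)
    next
      case 2
      have "from_nat n \<le> rat.act u (from_nat n)"
        using m 2 by (cases "n = m") auto
      also have "\<dots> < rat.act u (rat.act v (from_nat n))"
        using n(2) by (simp add: assms(3))
      finally show ?thesis using 2 by (simp add: min_absorb2)
    qed
  qed
  moreover have "rat.act (u + v) (from_nat k) = from_nat k" if "k < min m n" for k
    using that m(1) n(1) by simp
  ultimately show ?thesis unfolding up_def by blast
qed

lemma up_total:
  assumes "\<And>x y. rat.act u x < rat.act u y \<longleftrightarrow> x < y" "\<exists>t. rat.act u t \<noteq> t"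
  shows "up u \<or> up (- u)"
proof -
  from assms(2) have "\<exists>n. rat.act u (from_nat n) \<noteq> from_nat n" by (metis from_nat_to_nat)
  define n where "n = (LEAST n. rat.act u (from_nat n) \<noteq> from_nat n)"
  have n: "rat.act u (from_nat n) \<noteq> from_nat n"
    unfolding n_def by (rule LeastI_ex) fact
  have fixed: "rat.act u (from_nat m) = from_nat m" if "m < n" for m
    using not_less_Least[of m "\<lambda>n. rat.act u (from_nat n) \<noteq> from_nat n"] that by (simp add: n_def)
  then have fixed': "rat.act (- u) (from_nat m) = from_nat m" if "m < n" for m
    using that by (metis rat.act_minus_cancel(2))
  show ?thesis
  proof (cases "from_nat n < rat.act u (from_nat n)")
    case True
    then show ?thesis using fixed unfolding up_def by blast
  next
    case False
    with n have "rat.act u (from_nat n) < rat.act u (rat.act (- u) (from_nat n))" by simp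
    then have "from_nat n < rat.act (- u) (from_nat n)" by (simp only: assms(1))
    then show ?thesis using fixed' unfolding up_def by blast
  qed
qed

definition pos_cone :: "pb set" where
  "pos_cone = {- f + u + h |f u h. f \<in> amon \<and> h \<in> amon \<and> u \<in> sigma_pos} \<union>
     {- f + h |f h. f \<in> amon \<and> h \<in> amon \<and> up (- f + h)}"

lemma pos_cone_sigma_pos:
  "f \<in> amon \<Longrightarrow> h \<in> amon \<Longrightarrow> u \<in> sigma_pos \<Longrightarrow> - f + u + h \<in> pos_cone"
  unfolding pos_cone_def by blast

lemma pos_cone_up:
  "f \<in> amon \<Longrightarrow> h \<in> amon \<Longrightarrow> up (- f + h) \<Longrightarrow> - f + h \<in> pos_cone"
  unfolding pos_cone_def by blast

lemma rat_act_fraction_less_iff: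
  "f \<in> amon \<Longrightarrow> h \<in> amon \<Longrightarrow> rat.act (- f + h) x < rat.act (- f + h) y \<longleftrightarrow> x < y"
  by (simp add: rat_act_less_iff rat_act_minus_less_iff)

text \<open>A sigma-positive \<open>u\<close> in a representation of \<open>0\<close> would equal
  \<open>f - h\<close>, hence act increasingly on the rationals and be trivial.\<close>

lemma zero_notin_pos_cone: "0 \<notin> pos_cone"
proof
  assume "0 \<in> pos_cone"
  then consider f u h where "f \<in> amon" "h \<in> amon" "u \<in> sigma_pos" "0 = - f + u + h"
    | f h where "0 = - f + h" "up (- f + h)"
    unfolding pos_cone_def by blast
  then show False
  proof cases
    case 1
    have "f + (- f + u + h) = f" using 1(4) by simp
    then have "u + h = f" by (simp add: add.assoc)
    then have "u = f - h" by auto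
    then have "u = 0" using braids_eq_amon_diff[OF sigma_pos_braids] 1(1-3) by blast
    then show False using 1(3) zero_notin_sigma_pos by simp
  next
    case 2
    from 2(2) show False unfolding 2(1)[symmetric] by (simp add: up_def)
  qed
qed

lemma pos_cone_total: "u = 0 \<or> u \<in> pos_cone \<or> - u \<in> pos_cone"
proof -
  obtain f b h where u: "f \<in> amon" "b \<in> braids 0" "h \<in> amon" "u = - f + b + h"
    using pb_decomposition by blast
  have mu: "- u = - h + - b + f" by (simp add: u(4) group_add_normal del: add_uminus_conv_diff)
  consider "b \<in> sigma_pos" | "- b \<in> sigma_pos" | "b = 0" using braids_trichotomy[OF u(2)] by blast
  then show ?thesis
  proof cases
    case 1
    then show ?thesis using pos_cone_sigma_pos u by simp
  next
    case 2
    then show ?thesis using pos_cone_sigma_pos[OF u(3,1)] unfolding mu by blast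
  next
    case 3
    then have eq: "u = - f + h" "- u = - h + f" using u(4) mu by simp_all
    show ?thesis
    proof (cases "\<exists>t. rat.act u t \<noteq> t")
      case True
      then have "up u \<or> up (- u)"
        using rat_act_fraction_less_iff[OF u(1,3)] unfolding eq(1)[symmetric] by (intro up_total)
      moreover have "up u \<Longrightarrow> u \<in> pos_cone"
        using pos_cone_up[OF u(1,3)] unfolding eq(1)[symmetric] .
      moreover have "up (- u) \<Longrightarrow> - u \<in> pos_cone"
        using pos_cone_up[OF u(3,1)] unfolding eq(2)[symmetric] .
      ultimately show ?thesis by blast
    next
      case False
      then have "rat.act h t = rat.act f t" for t
        using rat.act_plus[of f u t] by (simp add: eq(1))
      then have "h = f" using u by (intro amon_faithful)
      then show ?thesis by (simp add: eq(1))
    qed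
  qed
qed

lemma pos_cone_plus:
  assumes "u \<in> pos_cone" "v \<in> pos_cone"
  shows "u + v \<in> pos_cone"
proof -
  \<comment> \<open>This treats trivial and sigma-positive middle factors uniformly:
    \<open>x \<in> U x\<close> says that \<open>x\<close> is one or the other, and cabling stays
    within \<open>U x\<close>.\<close>
  define U where "U = (\<lambda>w :: pb. if w = 0 then {0} else sigma_pos)"
  have cab: "cables 0 (U w) w'" if "w' \<in> U w" for w w'
    using that by (auto simp: U_def cables_zero sigma_pos_cables split: if_splits)
  have form: "\<exists>f\<in>amon. \<exists>h\<in>amon. \<exists>x. x \<in> U x \<and> w = - f + x + h \<and> (x = 0 \<longrightarrow> up w)"
    if w: "w \<in> pos_cone" for w
  proof -
    from w consider f x h where "f \<in> amon" "h \<in> amon" "x \<in> sigma_pos" "w = - f + x + h"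
      | f h where "f \<in> amon" "h \<in> amon" "w = - f + h" "up w"
      unfolding pos_cone_def by blast
    then show ?thesis
    proof cases
      case 1
      then have "x \<noteq> 0" using zero_notin_sigma_pos by blast
      with 1 show ?thesis unfolding U_def by force
    next
      case 2
      then show ?thesis by (intro bexI[of _ f] bexI[of _ h] exI[of _ 0]) (simp_all add: U_def)
    qed
  qed
  obtain f x h where u: "f \<in> amon" "h \<in> amon" "x \<in> U x" "u = - f + x + h" "x = 0 \<longrightarrow> up u"
    using form[OF assms(1)] by blast
  obtain f' y h' where v: "f' \<in> amon" "h' \<in> amon" "y \<in> U y" "v = - f' + y + h'" "y = 0 \<longrightarrow> up v"
    using form[OF assms(2)] by blast
  \<comment> \<open>The inner part \<open>h - f'\<close> is turned around into
    \<open>- e + e'\<close>; then \<open>- e\<close> crosses \<open>x\<close> to the left and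
    \<open>e'\<close> crosses \<open>y\<close> to the right.\<close>
  obtain e e' where e: "e \<in> amon" "e' \<in> amon" "h - f' = - e + e'"
    using amon_diff[OF v(1) u(2)] by blast
  obtain k x' where x': "k \<in> amon" "x' \<in> U x" "k + x = x' + e"
    using cables_amon_right[OF e(1) cab u(3)] by blast
  obtain l y' where y': "l \<in> amon" "y' \<in> U y" "e' + y = y' + l"
    using cables_amon_left[OF e(2) cab v(3)] by blast
  have "u + v = - f + (x + (h - f')) + (y + h')"
    by (simp add: u v group_add_normal del: add_uminus_conv_diff)
  also have "\<dots> = - f + (x + - e) + (e' + y) + h'"
    by (simp add: e(3) add.assoc del: add_uminus_conv_diff)
  also have "x + - e = - k + x'"
  proof -
    have "- k + (k + x) + - e = - k + (x' + e) + - e" by (simp only: x'(3))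
    then show ?thesis by (simp add: add.assoc del: add_uminus_conv_diff)
  qed
  also have "- f + (- k + x') + (e' + y) + h' = - (k + f) + (x' + y') + (l + h')"
    by (simp only: y'(3) minus_add add.assoc)
  finally have uv: "u + v = - (k + f) + (x' + y') + (l + h')" .
  show ?thesis
  proof (cases "x = 0 \<and> y = 0")
    case True
    then have "up (u + v)"
      using u v rat_act_fraction_less_iff[OF u(1,2)] by (intro up_plus) simp_all
    moreover have "u + v = - (e + f) + (e' + h')"
    proof -
      have "u + v = - f + (h - f') + h'"
        using True by (simp add: u(4) v(4) group_add_normal del: add_uminus_conv_diff)
      then show ?thesis by (simp only: e(3) minus_add add.assoc)
    qed
    ultimately show ?thesis using pos_cone_up[of "e + f" "e' + h'"] u(1) v(2) e(1,2) by auto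
  next
    case False
    then have "x' + y' \<in> sigma_pos"
      using x'(2) y'(2) by (auto simp: U_def intro: sigma_pos_plus split: if_splits)
    moreover have "k + f \<in> amon" "l + h' \<in> amon" using x' y' u v by auto
    ultimately show ?thesis unfolding uv by (intro pos_cone_sigma_pos)
  qed
qed

section \<open>Left orderability and zero divisors\<close>

theorem left_orderable_B_bullet: "left_orderable B_bullet"
proof -
  interpret group B_bullet by (rule group_B_bullet)
  define less where "less = (\<lambda>x y. - Abs_pb x + Abs_pb y \<in> pos_cone)"
  define r where "r = {(x, y). x \<in> carrier B_bullet \<and> y \<in> carrier B_bullet \<and> (x = y \<or> less x y)}"
  have trans: "less x z" if "less x y" "less y z" for x y z
    using pos_cone_plus[of "- Abs_pb x + Abs_pb y" "- Abs_pb y + Abs_pb z"] that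
    by (simp add: less_def add.assoc)
  have irrefl: "\<not> less x x" for x
    by (simp add: less_def zero_notin_pos_cone)
  have total: "x = y \<or> less x y \<or> less y x" if "x \<in> carrier B_bullet" "y \<in> carrier B_bullet" for x y
  proof -
    have "- (- Abs_pb x + Abs_pb y) = - Abs_pb y + Abs_pb x" by (simp add: minus_add)
    moreover have "- Abs_pb x + Abs_pb y = 0 \<Longrightarrow> x = y"
      using that by (metis Abs_pb_inverse add.right_inverse add_minus_cancel add_0_right)
    ultimately show ?thesis
      using pos_cone_total[of "- Abs_pb x + Abs_pb y"] by (auto simp: less_def)
  qed
  have mult: "less (g \<otimes>\<^bsub>B_bullet\<^esub> x) (g \<otimes>\<^bsub>B_bullet\<^esub> y)"
    if "less x y" "g \<in> carrier B_bullet" "x \<in> carrier B_bullet" "y \<in> carrier B_bullet" for g x y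
  proof -
    have "Abs_pb (g \<otimes>\<^bsub>B_bullet\<^esub> z) = Abs_pb g + Abs_pb z" if "z \<in> carrier B_bullet" for z
      using that \<open>g \<in> carrier B_bullet\<close> by (simp add: plus_pb_def Abs_pb_inverse)
    then show ?thesis
      using that by (simp add: less_def group_add_normal del: add_uminus_conv_diff)
  qed
  have "r \<subseteq> carrier B_bullet \<times> carrier B_bullet" "refl_on (carrier B_bullet) r"
    by (auto simp: r_def refl_on_def)
  moreover have "trans r"
    unfolding r_def trans_def using trans by blast
  moreover have "antisym r"
    unfolding r_def antisym_def using trans irrefl by blast
  moreover have "total_on (carrier B_bullet) r"
    unfolding r_def total_on_def using total by blast
  ultimately have "linear_order_on (carrier B_bullet) r"
    by (simp add: order_on_defs)
  then show ?thesis
    unfolding left_orderable_def using mult by (intro exI[of _ r]) (auto simp: r_def)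
qed

section \<open>Leading terms in the group algebra\<close>

lemma linear_order_on_has_max:
  assumes "linear_order_on C r" "finite A" "A \<noteq> {}" "A \<subseteq> C"
  shows "\<exists>m\<in>A. \<forall>x\<in>A. (x, m) \<in> r"
proof -
  have total: "(x, y) \<in> r \<or> (y, x) \<in> r" if "x \<in> C" "y \<in> C" for x y
    using assms(1) that by (cases "x = y") (auto simp: order_on_defs refl_on_def total_on_def)
  have trans: "(x, z) \<in> r" if "(x, y) \<in> r" "(y, z) \<in> r" for x y z
    using assms(1) that by (auto simp: order_on_defs elim: transE)
  from assms(2-4) show ?thesis
  proof (induction rule: finite_ne_induct)
    case (singleton x)
    then show ?case using total[of x x] by simp
  next
    case (insert x A)
    then obtain m where m: "m \<in> A" "\<forall>y\<in>A. (y, m) \<in> r" by blast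
    consider "(x, m) \<in> r" | "(m, x) \<in> r"
      using total[of x m] insert.prems m(1) by blast
    then show ?case
    proof cases
      case 1
      then show ?thesis using m by blast
    next
      case 2
      then have "(y, x) \<in> r" if "y \<in> A" for y using trans[of y m x] m(2) that by blast
      then show ?thesis using total[of x x] insert.prems by blast
    qed
  qed
qed

text \<open>The leading coefficient of a product comes from a single pair: the maximum \<open>y0\<close> of the
  right support, and the element \<open>x0\<close> of the left support that maximizes \<open>x0 y0\<close>.\<close>

theorem left_orderable_no_zero_divisors:
  assumes "group G" "left_orderable G"
  shows "has_no_zero_divisors (group_algebra G :: ('a \<Rightarrow>\<^sub>0 'k :: idom) ring)"
  unfolding has_no_zero_divisors_def
proof (intro ballI impI, rule ccontr)
  interpret group G by fact
  fix f h :: "'a \<Rightarrow>\<^sub>0 'k"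
  assume "f \<in> carrier (group_algebra G)" "h \<in> carrier (group_algebra G)"
    and zero: "f \<otimes>\<^bsub>group_algebra G\<^esub> h = \<zero>\<^bsub>group_algebra G\<^esub>"
    and ne: "\<not> (f = \<zero>\<^bsub>group_algebra G\<^esub> \<or> h = \<zero>\<^bsub>group_algebra G\<^esub>)"
  then have F: "Poly_Mapping.keys f \<subseteq> carrier G" "Poly_Mapping.keys f \<noteq> {}"
    and H: "Poly_Mapping.keys h \<subseteq> carrier G" "Poly_Mapping.keys h \<noteq> {}"
    by (simp_all add: group_algebra_def)
  from assms(2) obtain r where r: "linear_order_on (carrier G) r"
    and mono: "\<And>g x y. g \<in> carrier G \<Longrightarrow> x \<in> carrier G \<Longrightarrow> y \<in> carrier G \<Longrightarrow> (x, y) \<in> r \<Longrightarrow>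
      (g \<otimes>\<^bsub>G\<^esub> x, g \<otimes>\<^bsub>G\<^esub> y) \<in> r"
    unfolding left_orderable_def by blast
  have antisym: "x = y" if "(x, y) \<in> r" "(y, x) \<in> r" for x y
    using r that by (auto simp: order_on_defs antisym_def)
  obtain y0 where y0: "y0 \<in> Poly_Mapping.keys h" "\<And>y. y \<in> Poly_Mapping.keys h \<Longrightarrow> (y, y0) \<in> r"
    using linear_order_on_has_max[OF r _ H(2,1)] by auto
  have "(\<lambda>x. x \<otimes>\<^bsub>G\<^esub> y0) ` Poly_Mapping.keys f \<subseteq> carrier G"
    using F H y0(1) by (auto simp: subset_iff)
  then obtain x0 where x0: "x0 \<in> Poly_Mapping.keys f"
    "\<And>x. x \<in> Poly_Mapping.keys f \<Longrightarrow> (x \<otimes>\<^bsub>G\<^esub> y0, x0 \<otimes>\<^bsub>G\<^esub> y0) \<in> r"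
    using linear_order_on_has_max[OF r, of "(\<lambda>x. x \<otimes>\<^bsub>G\<^esub> y0) ` Poly_Mapping.keys f"] F(2) by auto
  have uniq: "x = x0 \<and> y = y0"
    if "x \<in> Poly_Mapping.keys f" "y \<in> Poly_Mapping.keys h" "x \<otimes>\<^bsub>G\<^esub> y = x0 \<otimes>\<^bsub>G\<^esub> y0" for x y
  proof -
    have c: "x \<in> carrier G" "y \<in> carrier G" "x0 \<in> carrier G" "y0 \<in> carrier G"
      using that F H x0 y0 by auto
    \<comment> \<open>Left invariance applied to \<open>y\<close> below \<open>y0\<close> gives that
      \<open>x0 y0 = x y\<close> is below \<open>x y0\<close>, which by choice of \<open>x0\<close>
      is below \<open>x0 y0\<close>.\<close>
    have "(x0 \<otimes>\<^bsub>G\<^esub> y0, x \<otimes>\<^bsub>G\<^esub> y0) \<in> r"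
      using mono[OF c(1,2,4) y0(2)[OF that(2)]] that(3) by simp
    then have "x \<otimes>\<^bsub>G\<^esub> y0 = x0 \<otimes>\<^bsub>G\<^esub> y0" using x0(2)[OF that(1)] antisym by blast
    then have "x = x0" using c by simp
    then show ?thesis using that(3) c by simp
  qed
  have "Poly_Mapping.lookup (convolution G f h) (x0 \<otimes>\<^bsub>G\<^esub> y0) =
      (\<Sum>x\<in>Poly_Mapping.keys f. \<Sum>y\<in>Poly_Mapping.keys h.
        if x = x0 \<and> y = y0 then Poly_Mapping.lookup f x * Poly_Mapping.lookup h y else 0)"
    unfolding convolution_def lookup_sum lookup_single when_def
    by (intro sum.cong refl) (use uniq in auto)
  also have "\<dots> = (\<Sum>x\<in>Poly_Mapping.keys f. if x = x0 then
      (\<Sum>y\<in>Poly_Mapping.keys h. if y = y0 then Poly_Mapping.lookup f x * Poly_Mapping.lookup h y else 0) else 0)"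
    by (intro sum.cong) auto
  also have "\<dots> = Poly_Mapping.lookup f x0 * Poly_Mapping.lookup h y0"
    using x0(1) y0(1) by simp
  also have "\<dots> \<noteq> 0"
    using x0(1) y0(1) by (simp add: in_keys_iff)
  finally show False using zero by (simp add: group_algebra_def)
qed

theorem corollary4p12:
  "left_orderable B_bullet \<and>
   has_no_zero_divisors (group_algebra B_bullet :: (braid_gen word set \<Rightarrow>\<^sub>0 complex) ring)"
  using left_orderable_B_bullet left_orderable_no_zero_divisors[OF group_B_bullet] by blast

end
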